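(* Let $X$ be a continuous vector field on the circle. Then for all $p\in\mathbb{H}^2$, $$\lVert\overline{\partial}\,\mathrm{HL}(X)_p\rVert\le 6\,w_X(\Pi(p)),$$ where $\Pi:\mathbb{H}^2\to\mathbb{D}^2$ is the radial projection.
   Context: Minkowski space $\mathbb{R}^{1,2}$ is $\mathbb{R}^3$ with $\langle x,y\rangle_{1,2}=-x_0y_0+x_1y_1+x_2y_2$. The hyperbolic plane is $\mathbb{H}^2=\{x\in\mathbb{R}^{1,2}: \langle x,x\rangle_{1,2}=-1,\ x_0>0\}$ with the induced Riemannian metric $g$, Levi-Civita connection $\nabla$ and complex structure $\mathrm{J}_p(v)=p\boxtimes v$, where $\langle x\boxtimes y,v\rangle_{1,2}=\det(x,y,v)$ for all $v$. $\mathrm{grad}$ and $\Delta$ are the gradient and Laplace-Beltrami operator ($\Delta=\mathrm{tr}\,\mathrm{Hess}$). $\mathbb{D}^2\subset\mathbb{R}^2\cong\mathbb{C}$ is the open unit disk, $\mathbb{S}^1=\partial\mathbb{D}^2$, $\Pi(x_0,x_1,x_2)=(x_1/x_0,x_2/x_0)$; for $u:\mathbb{H}^2\to\mathbb{R}$ set $\overline{u}(\eta)=\sqrt{1-|\eta|^2}\,u(\Pi^{-1}(\eta))$. The support function $\phi_X:\mathbb{S}^1\to\mathbb{R}$ is defined by $X(z)=iz\,\phi_X(z)$. It is known that there is a unique smooth $u_X:\mathbb{H}^2\to\mathbb{R}$ with $\Delta u_X-2u_X=0$ and $\overline{u_X}$ extending continuously to $\overline{\mathbb{D}^2}$ with $\overline{u_X}|_{\mathbb{S}^1}=\phi_X$.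 Then $\mathrm{HL}(X):=\mathrm{J}\,\mathrm{grad}(u_X)$. $\overline{\partial}V(Y):=\frac12(\nabla_YV+\mathrm{J}\nabla_{\mathrm{J}Y}V)$, and $\lVert\overline{\partial}V_p\rVert$ is the operator norm on $(\mathrm{T}_p\mathbb{H}^2,g)$. For $z\in\overline{\mathbb{D}^2}$, $\phi_X^-(z)=\sup\{a(z)\}$ over affine $a:\mathbb{R}^2\to\mathbb{R}$ with $a|_{\mathbb{S}^1}\le\phi_X$, $\phi_X^+(z)=\inf\{a(z)\}$ over affine $a$ with $\phi_X\le a|_{\mathbb{S}^1}$, and $w_X(\eta)=\frac{\phi_X^+(\eta)-\phi_X^-(\eta)}{\sqrt{1-|\eta|^2}}$ for $\eta\in\mathbb{D}^2$. *)

theory Defs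
  imports "HOL-Analysis.Analysis"
begin

section \<open>The hyperboloid in Minkowski space\<close>

text \<open>
  The coordinates \<open>x\<^sub>0, x\<^sub>1, x\<^sub>2\<close> of a vector \<open>x\<close> are \<open>x $ 1, x $ 2, x $ 3\<close>.
\<close>

definition mink :: "real^3 \<Rightarrow> real^3 \<Rightarrow> real" where
  "mink x y = - (x $ 1 * y $ 1) + x $ 2 * y $ 2 + x $ 3 * y $ 3"

definition H2 :: "(real^3) set" where
  "H2 = {x. mink x x = -1 \<and> x $ 1 > 0}"

definition tangent :: "real^3 \<Rightarrow> (real^3) set" where
  "tangent p = {v. mink p v = 0}"

definition mcross :: "real^3 \<Rightarrow> real^3 \<Rightarrow> real^3" where
  "mcross x y = (THE w. \<forall>v. mink w v = det (vector [x, y, v]))"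

definition J :: "real^3 \<Rightarrow> real^3 \<Rightarrow> real^3" where
  "J p v = mcross p v"

definition gnorm :: "real^3 \<Rightarrow> real" where
  "gnorm v = sqrt (mink v v)"

definition tangent_opnorm :: "real^3 \<Rightarrow> (real^3 \<Rightarrow> real^3) \<Rightarrow> real" where
  "tangent_opnorm p A = (SUP v \<in> {v \<in> tangent p. gnorm v \<le> 1}. gnorm (A v))"


section \<open>Calculus on the hyperbolic plane\<close>

text \<open>
  Functions and vector fields on \<open>H2\<close> are represented by functions on \<open>real^3\<close>, of which only
  the values on \<open>H2\<close> matter. The differential at \<open>p\<close> in a tangent direction is the Frechet
  derivative within \<open>H2\<close>. That derivative is not unique as a linear map on the ambient space,
  but its restriction to \<open>tangent p\<close> is, see \<open>derivative_within_H2_unique\<close> below.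
\<close>

definition dH :: "(real^3 \<Rightarrow> 'b::real_normed_vector) \<Rightarrow> real^3 \<Rightarrow> real^3 \<Rightarrow> 'b" where
  "dH f p v = frechet_derivative f (at p within H2) v"

primrec Ck_on :: "nat \<Rightarrow> (real^3) set \<Rightarrow> (real^3 \<Rightarrow> real) \<Rightarrow> bool" where
  "Ck_on 0 U f \<longleftrightarrow> continuous_on U f"
| "Ck_on (Suc k) U f \<longleftrightarrow>
     (\<exists>f'. (\<forall>x\<in>U. (f has_derivative f' x) (at x)) \<and> (\<forall>v. Ck_on k U (\<lambda>x. f' x v)))"

text \<open>Smoothness on the embedded submanifold \<open>H2\<close>: existence of a smooth extension.\<close>

definition smooth_on_H2 :: "(real^3 \<Rightarrow> real) \<Rightarrow> bool" where
  "smooth_on_H2 u \<longleftrightarrow>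
     (\<exists>U F. open U \<and> H2 \<subseteq> U \<and> (\<forall>k. Ck_on k U F) \<and> (\<forall>x\<in>H2. F x = u x))"

definition grad :: "(real^3 \<Rightarrow> real) \<Rightarrow> real^3 \<Rightarrow> real^3" where
  "grad u p = (THE w. w \<in> tangent p \<and> (\<forall>v\<in>tangent p. mink w v = dH u p v))"

text \<open>
  The Levi-Civita connection of \<open>H2\<close>: \<open>nabla V p v\<close> is the covariant derivative of the
  field \<open>V\<close> at \<open>p\<close> in direction \<open>v\<close>, that is, the component in \<open>tangent p\<close> of the ambient
  derivative. (\<open>mink p p = -1\<close> is the reason for the plus sign in \<open>tproj\<close>.) The lemmas
  \<open>nabla_tangent\<close> to \<open>nabla_torsion_free\<close> establish the properties that characterise it.
\<close>

definition tproj :: "real^3 \<Rightarrow> real^3 \<Rightarrow> real^3" where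
  "tproj p w = w + mink w p *\<^sub>R p"

definition nabla :: "(real^3 \<Rightarrow> real^3) \<Rightarrow> real^3 \<Rightarrow> real^3 \<Rightarrow> real^3" where
  "nabla V p v = tproj p (dH V p v)"

definition Hess :: "(real^3 \<Rightarrow> real) \<Rightarrow> real^3 \<Rightarrow> real^3 \<Rightarrow> real^3 \<Rightarrow> real" where
  "Hess u p v w = mink (nabla (grad u) p v) w"

definition orthonormal_frame :: "real^3 \<Rightarrow> real^3 \<Rightarrow> real^3 \<Rightarrow> bool" where
  "orthonormal_frame p e f \<longleftrightarrow>
     e \<in> tangent p \<and> f \<in> tangent p \<and> mink e e = 1 \<and> mink f f = 1 \<and> mink e f = 0"

definition laplacian :: "(real^3 \<Rightarrow> real) \<Rightarrow> real^3 \<Rightarrow> real" where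
  "laplacian u p = (THE t. \<exists>e f. orthonormal_frame p e f \<and> t = Hess u p e e + Hess u p f f)"

definition dbar :: "(real^3 \<Rightarrow> real^3) \<Rightarrow> real^3 \<Rightarrow> real^3 \<Rightarrow> real^3" where
  "dbar V p v = (1/2) *\<^sub>R (nabla V p v + J p (nabla V p (J p v)))"


section \<open>Vector fields on the circle and their extension\<close>

definition continuous_circle_field :: "(complex \<Rightarrow> complex) \<Rightarrow> bool" where
  "continuous_circle_field X \<longleftrightarrow>
     continuous_on (sphere 0 1) X \<and> (\<forall>z\<in>sphere 0 1. X z \<bullet> z = 0)"

definition support_fun :: "(complex \<Rightarrow> complex) \<Rightarrow> complex \<Rightarrow> real" where
  "support_fun X z = (THE r. X z = \<i> * z * complex_of_real r)"

definition radial_proj :: "real^3 \<Rightarrow> complex" where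
  "radial_proj x = Complex (x $ 2 / x $ 1) (x $ 3 / x $ 1)"

definition disk_fun :: "(real^3 \<Rightarrow> real) \<Rightarrow> complex \<Rightarrow> real" where
  "disk_fun u \<eta> = sqrt (1 - (norm \<eta>)\<^sup>2) * u (the_inv_into H2 radial_proj \<eta>)"

definition is_HL_potential :: "(complex \<Rightarrow> complex) \<Rightarrow> (real^3 \<Rightarrow> real) \<Rightarrow> bool" where
  "is_HL_potential X u \<longleftrightarrow>
     smooth_on_H2 u \<and> (\<forall>p\<in>H2. laplacian u p - 2 * u p = 0) \<and>
     (\<exists>h. continuous_on (cball 0 1) h \<and> (\<forall>\<eta>\<in>ball 0 1. h \<eta> = disk_fun u \<eta>) \<and>
          (\<forall>z\<in>sphere 0 1. h z = support_fun X z))"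

text \<open>
  The choice operator is used because the potential is unique only on \<open>H2\<close>; its values
  elsewhere are arbitrary and irrelevant.
\<close>

definition HL_potential :: "(complex \<Rightarrow> complex) \<Rightarrow> real^3 \<Rightarrow> real" where
  "HL_potential X = (SOME u. is_HL_potential X u)"

definition HL :: "(complex \<Rightarrow> complex) \<Rightarrow> real^3 \<Rightarrow> real^3" where
  "HL X p = J p (grad (HL_potential X) p)"

definition affine_fun :: "(complex \<Rightarrow> real) \<Rightarrow> bool" where
  "affine_fun a \<longleftrightarrow> (\<exists>l c. linear l \<and> a = (\<lambda>z. l z + c))"

definition phi_minus :: "(complex \<Rightarrow> complex) \<Rightarrow> complex \<Rightarrow> real" where
  "phi_minus X z = Sup {a z | a. affine_fun a \<and> (\<forall>\<zeta>\<in>sphere 0 1. a \<zeta> \<le> support_fun X \<zeta>)}"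

definition phi_plus :: "(complex \<Rightarrow> complex) \<Rightarrow> complex \<Rightarrow> real" where
  "phi_plus X z = Inf {a z | a. affine_fun a \<and> (\<forall>\<zeta>\<in>sphere 0 1. support_fun X \<zeta> \<le> a \<zeta>)}"

definition width_fun :: "(complex \<Rightarrow> complex) \<Rightarrow> complex \<Rightarrow> real" where
  "width_fun X \<eta> = (phi_plus X \<eta> - phi_minus X \<eta>) / sqrt (1 - (norm \<eta>)\<^sup>2)"


section \<open>The connection \<open>nabla\<close> is the Levi-Civita connection\<close>

lemma bounded_bilinear_mink: "bounded_bilinear mink"
proof -
  have "bounded_bilinear (\<lambda>x y::real^3. - (x $ 1 * y $ 1) + x $ 2 * y $ 2 + x $ 3 * y $ 3)"
    unfolding bilinear_conv_bounded_bilinear [symmetric] bilinear_def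
    by (auto intro!: linearI simp: algebra_simps)
  then show ?thesis by (simp add: mink_def [abs_def])
qed

lemmas mink_simps =
  bounded_bilinear.add_left [OF bounded_bilinear_mink]
  bounded_bilinear.add_right [OF bounded_bilinear_mink]
  bounded_bilinear.diff_left [OF bounded_bilinear_mink]
  bounded_bilinear.diff_right [OF bounded_bilinear_mink]
  bounded_bilinear.scaleR_left [OF bounded_bilinear_mink]
  bounded_bilinear.scaleR_right [OF bounded_bilinear_mink]

lemma mink_commute: "mink x y = mink y x"
  by (simp add: mink_def mult.commute)

lemma H2_curve:
  assumes p: "p \<in> H2" and v: "v \<in> tangent p"
  obtains c e where "e > 0" "c 0 = p" "\<And>t. \<bar>t\<bar> < e \<Longrightarrow> c t \<in> H2"
    "(c has_derivative (\<lambda>t. t *\<^sub>R v)) (at 0)"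
proof -
  define m where "m = mink v v"
  define c where "c t = (1 / sqrt (1 - t\<^sup>2 * m)) *\<^sub>R (p + t *\<^sub>R v)" for t :: real
  have pp: "mink p p = -1" and p0: "p $ 1 > 0" and pv: "mink p v = 0"
    using p v by (auto simp: H2_def tangent_def)
  have nhds0: "(f \<longlongrightarrow> f 0) (nhds 0)" if "isCont f 0" for f :: "real \<Rightarrow> real"
    using that by (simp add: isCont_def tendsto_at_iff_tendsto_nhds)
  have "((\<lambda>t::real. 1 - t\<^sup>2 * m) \<longlongrightarrow> 1 - 0\<^sup>2 * m) (nhds 0)"
    by (rule nhds0; intro continuous_intros)
  moreover have "((\<lambda>t::real. (p + t *\<^sub>R v) $ 1) \<longlongrightarrow> (p + 0 *\<^sub>R v) $ 1) (nhds 0)"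
    by (rule nhds0; intro continuous_intros)
  ultimately have "\<forall>\<^sub>F t in nhds (0::real). 1 - t\<^sup>2 * m > 0 \<and> (p + t *\<^sub>R v) $ 1 > 0"
    using p0 by (intro eventually_conj; elim order_tendstoD(1)) auto
  then obtain e where e: "e > 0"
      "\<And>t. \<bar>t\<bar> < e \<Longrightarrow> 1 - t\<^sup>2 * m > 0 \<and> (p + t *\<^sub>R v) $ 1 > 0"
    unfolding eventually_nhds_metric by (auto simp: dist_real_def)
  have "c t \<in> H2" if "\<bar>t\<bar> < e" for t
  proof -
    have pos: "1 - t\<^sup>2 * m > 0" "(p + t *\<^sub>R v) $ 1 > 0" using e(2)[OF that] by auto
    have "mink (p + t *\<^sub>R v) (p + t *\<^sub>R v) = - (1 - t\<^sup>2 * m)"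
      by (simp add: mink_simps pp pv mink_commute[of v p] m_def power2_eq_square)
    moreover have "mink (r *\<^sub>R x) (r *\<^sub>R x) = r\<^sup>2 * mink x x" for r x
      by (simp add: mink_simps(5,6) power2_eq_square)
    ultimately have "mink (c t) (c t) = (1 / sqrt (1 - t\<^sup>2 * m))\<^sup>2 * - (1 - t\<^sup>2 * m)"
      by (simp only: c_def)
    then have "mink (c t) (c t) = -1"
      using pos(1) by (simp add: power_divide divide_eq_eq)
    moreover have "c t $ 1 > 0"
      using pos unfolding c_def vector_scaleR_component real_scaleR_def by (intro mult_pos_pos) auto
    ultimately show ?thesis by (simp add: H2_def)
  qed
  moreover have "(c has_derivative (\<lambda>t. t *\<^sub>R v)) (at 0)"
    unfolding c_def by (auto intro!: derivative_eq_intros)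
  moreover have "c 0 = p" by (simp add: c_def)
  ultimately show thesis using e(1) that by blast
qed

lemma derivative_within_H2_unique:
  assumes p: "p \<in> H2" and v: "v \<in> tangent p"
    and D: "(f has_derivative D) (at p within H2)"
    and D': "(f has_derivative D') (at p within H2)"
  shows "D v = D' v"
proof -
  obtain c e where c: "e > 0" "c 0 = p" "\<And>t. \<bar>t\<bar> < e \<Longrightarrow> c t \<in> H2"
    "(c has_derivative (\<lambda>t. t *\<^sub>R v)) (at 0)"
    using H2_curve[OF p v] by blast
  define S where "S = {-e<..<e}"
  have S: "open S" "0 \<in> S" "c ` S \<subseteq> H2" using c by (auto simp: S_def)
  have cS: "(c has_derivative (\<lambda>t. t *\<^sub>R v)) (at 0 within S)"
    using c(4) has_derivative_at_withinI by blast
  have *: "((\<lambda>t. f (c t)) has_derivative (\<lambda>t. E (t *\<^sub>R v))) (at 0)"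
    if E: "(f has_derivative E) (at p within H2)" for E
  proof -
    have "(f has_derivative E) (at (c 0) within c ` S)"
      using E c(2) S(3) has_derivative_subset by metis
    from has_derivative_in_compose[OF cS this] show ?thesis
      using S(1,2) at_within_open by metis
  qed
  have "(\<lambda>t. D (t *\<^sub>R v)) = (\<lambda>t. D' (t *\<^sub>R v))"
    using *[OF D] *[OF D'] has_derivative_unique by blast
  from fun_cong[OF this, of 1] show ?thesis by simp
qed

lemma dH_eq:
  assumes "p \<in> H2" "v \<in> tangent p" "(f has_derivative D) (at p within H2)"
  shows "dH f p v = D v"
proof -
  have "f differentiable (at p within H2)" using assms(3) by (auto simp: differentiable_def)
  then have "(f has_derivative frechet_derivative f (at p within H2)) (at p within H2)"
    by (simp add: frechet_derivative_works)
  from derivative_within_H2_unique[OF assms(1,2) this assms(3)] show ?thesis by (simp add: dH_def)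
qed

lemma has_derivative_dH:
  "f differentiable (at p within H2) \<Longrightarrow> (f has_derivative dH f p) (at p within H2)"
  by (simp add: frechet_derivative_works dH_def [abs_def])

lemma tproj_tangent: "p \<in> H2 \<Longrightarrow> tproj p w \<in> tangent p"
  by (simp add: H2_def tangent_def tproj_def mink_simps mink_commute)

lemma tproj_id: "w \<in> tangent p \<Longrightarrow> tproj p w = w"
  by (simp add: tangent_def tproj_def mink_commute)

lemma tproj_add: "tproj p (v + w) = tproj p v + tproj p w"
  by (simp add: tproj_def mink_simps scaleR_add_left)

lemma tproj_scaleR: "tproj p (c *\<^sub>R w) = c *\<^sub>R tproj p w"
  by (simp add: tproj_def mink_simps scaleR_add_right)

lemma tproj_diff: "tproj p (v - w) = tproj p v - tproj p w"
  by (simp add: tproj_def mink_simps scaleR_diff_left)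

lemma mink_tproj: "w \<in> tangent p \<Longrightarrow> mink (tproj p v) w = mink v w"
  by (simp add: tproj_def tangent_def mink_simps)

lemma nabla_tangent: "p \<in> H2 \<Longrightarrow> nabla V p v \<in> tangent p"
  by (simp add: nabla_def tproj_tangent)

lemma nabla_linear_direction:
  assumes "V differentiable (at p within H2)"
  shows "linear (nabla V p)"
proof -
  have "linear (dH V p)" using has_derivative_dH[OF assms] has_derivative_linear by blast
  then show ?thesis
    by (intro linearI) (simp_all add: nabla_def tproj_add tproj_scaleR linear_add linear_scale)
qed

lemma nabla_add:
  assumes "p \<in> H2" "v \<in> tangent p"
    and "V differentiable (at p within H2)" "W differentiable (at p within H2)"
  shows "nabla (\<lambda>x. V x + W x) p v = nabla V p v + nabla W p v"
proof -
  have "dH (\<lambda>x. V x + W x) p v = dH V p v + dH W p v"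
    by (rule dH_eq[OF assms(1,2) has_derivative_add[OF has_derivative_dH has_derivative_dH]])
       (use assms in auto)
  then show ?thesis by (simp add: nabla_def tproj_add)
qed

lemma nabla_Leibniz:
  assumes "p \<in> H2" "v \<in> tangent p" "V p \<in> tangent p"
    and "f differentiable (at p within H2)" "V differentiable (at p within H2)"
  shows "nabla (\<lambda>x. f x *\<^sub>R V x) p v = f p *\<^sub>R nabla V p v + dH f p v *\<^sub>R V p"
proof -
  have "dH (\<lambda>x. f x *\<^sub>R V x) p v = f p *\<^sub>R dH V p v + dH f p v *\<^sub>R V p"
    by (rule dH_eq[OF assms(1,2) has_derivative_scaleR[OF has_derivative_dH has_derivative_dH]])
       (use assms in auto)
  then show ?thesis using assms(3) by (simp add: nabla_def tproj_add tproj_scaleR tproj_id)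
qed

lemma dH_mink:
  assumes "p \<in> H2" "v \<in> tangent p"
    and "V differentiable (at p within H2)" "W differentiable (at p within H2)"
  shows "dH (\<lambda>x. mink (V x) (W x)) p v = mink (V p) (dH W p v) + mink (dH V p v) (W p)"
  by (rule dH_eq[OF assms(1,2) bounded_bilinear.FDERIV[OF bounded_bilinear_mink
        has_derivative_dH has_derivative_dH]]) (use assms in auto)

lemma nabla_metric:
  assumes "p \<in> H2" "v \<in> tangent p" "V p \<in> tangent p" "W p \<in> tangent p"
    and "V differentiable (at p within H2)" "W differentiable (at p within H2)"
  shows "dH (\<lambda>x. mink (V x) (W x)) p v = mink (nabla V p v) (W p) + mink (V p) (nabla W p v)"
  using assms dH_mink[OF assms(1,2,5,6)]
  by (simp add: nabla_def mink_tproj mink_commute[of "V p"])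

text \<open>The right-hand side is the Lie bracket of the tangent fields \<open>V\<close> and \<open>W\<close>.\<close>

lemma nabla_torsion_free:
  assumes p: "p \<in> H2" and V: "\<And>x. x \<in> H2 \<Longrightarrow> V x \<in> tangent x"
    and W: "\<And>x. x \<in> H2 \<Longrightarrow> W x \<in> tangent x"
    and "V differentiable (at p within H2)" "W differentiable (at p within H2)"
  shows "nabla W p (V p) - nabla V p (W p) = dH W p (V p) - dH V p (W p)"
proof -
  have *: "mink p (dH Y p v) = - mink v (Y p)"
    if Y: "\<And>x. x \<in> H2 \<Longrightarrow> Y x \<in> tangent x" "Y differentiable (at p within H2)"
      and v: "v \<in> tangent p" for Y v
  proof -
    have id: "((\<lambda>x. x) has_derivative (\<lambda>x. x)) (at p within H2)" by (rule has_derivative_ident)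
    have "((\<lambda>x. mink x (Y x)) has_derivative (\<lambda>_. 0)) (at p within H2)"
      by (rule has_derivative_transform[OF p _ has_derivative_const[of 0]])
         (use Y(1) in \<open>auto simp: tangent_def\<close>)
    then have "dH (\<lambda>x. mink x (Y x)) p v = 0" using dH_eq[OF p v] by blast
    moreover have "dH (\<lambda>x. x) p v = v" using dH_eq[OF p v id] .
    ultimately show ?thesis
      using dH_mink[OF p v _ Y(2), of "\<lambda>x. x"] id by (auto simp: differentiable_def)
  qed
  have "dH W p (V p) - dH V p (W p) \<in> tangent p"
    using *[of W "V p"] *[of V "W p"] assms
    by (simp add: tangent_def mink_simps mink_commute[of "W p"])
  from tproj_id[OF this] show ?thesis by (simp add: nabla_def tproj_diff)
qed

end

theory Submission
  imports Defs
begin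

text \<open>
  The potential of \<open>HL X\<close> is explicit. Write \<open>horo p t = - mink p (1, cos t, sin t)\<close>. Then the
  potential with boundary values \<open>f = support_fun X\<close> is the average over \<open>t\<close> of
  \<open>f (cis t) / (horo p t)\<^sup>2\<close>, called \<open>poisson f\<close> below. This kernel is positive and reproduces
  affine functions (\<open>poisson_affine\<close>); these two properties alone give the boundary values, while
  the equation \<open>laplacian u = 2 u\<close> is a pointwise identity for the kernel. As \<open>HL_potential\<close> is
  specified by its properties only, uniqueness is needed as well (\<open>HL_potential_le\<close>). It follows from
  the maximum principle applied to the quotient of a difference of two potentials by
  \<open>p $ 1 + 1\<close>, a strict supersolution that is comparable with the growth allowed at infinity.

  For the estimate, \<open>J\<close> is parallel, so \<open>dbar (J grad u)\<close> is half the commutator of \<open>J\<close> with the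
  Hessian of \<open>u\<close>. It depends only on \<open>Hess u - u g\<close>, which vanishes for restrictions of linear
  functions, that is, for affine boundary values. Hence an affine minorant \<open>a\<close> of \<open>f\<close> may be
  subtracted, and \<open>f - a\<close> is nonnegative. The trace-free Hessian of \<open>horo p t powr (-2)\<close> is
  \<open>3 * horo p t powr (-2)\<close> times a reflection; integrating its norm against the nonnegative density
  gives \<open>3 * (u p - p $ 1 * a (radial_proj p))\<close> (\<open>dbar_rotated_gradient_bound\<close>). An affine majorant
  \<open>b\<close> of \<open>f\<close> bounds \<open>u p\<close> by \<open>p $ 1 * b (radial_proj p)\<close>. Since \<open>p $ 1\<close> is the reciprocal
  of \<open>sqrt (1 - (norm \<eta>)\<^sup>2)\<close> at \<open>\<eta> = radial_proj p\<close>, optimising over \<open>a\<close> and \<open>b\<close> yields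
  three times the width.
\<close>

section \<open>Minkowski products and tangent planes\<close>

lemma vec3_eqI: "x $ 1 = y $ 1 \<Longrightarrow> x $ 2 = y $ 2 \<Longrightarrow> x $ 3 = y $ 3 \<Longrightarrow> x = y" for x y :: "real^3"
  by (simp add: vec_eq_iff forall_3)

lemma mink_nondegenerate:
  assumes "\<And>v. mink w v = mink w' v"
  shows "w = w'"
proof -
  have "mink w (axis i 1) = mink w' (axis i 1)" for i by (rule assms)
  from this[of 1] this[of 2] this[of 3] show ?thesis
    by (intro vec3_eqI) (simp_all add: mink_def axis_def)
qed

lemma mcross_eq:
  "mcross x y = vector [x $ 3 * y $ 2 - x $ 2 * y $ 3, x $ 3 * y $ 1 - x $ 1 * y $ 3,
     x $ 1 * y $ 2 - x $ 2 * y $ 1]" (is "_ = ?w")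
proof -
  have "\<forall>v. mink ?w v = det (vector [x, y, v])"
    by (simp add: mink_def det_3 algebra_simps)
  then show ?thesis unfolding mcross_def
    by (intro the_equality) (auto intro: mink_nondegenerate)
qed

lemma mcross_component [simp]:
  "mcross x y $ 1 = x $ 3 * y $ 2 - x $ 2 * y $ 3"
  "mcross x y $ 2 = x $ 3 * y $ 1 - x $ 1 * y $ 3"
  "mcross x y $ 3 = x $ 1 * y $ 2 - x $ 2 * y $ 1"
  by (simp_all add: mcross_eq)

lemma bounded_bilinear_mcross: "bounded_bilinear mcross"
  unfolding bilinear_conv_bounded_bilinear [symmetric] bilinear_def
  by (auto intro!: linearI vec3_eqI simp: algebra_simps)

lemma mink_mcross: "mink (mcross x y) (mcross z w) = mink x w * mink y z - mink x z * mink y w"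
  by (simp add: mink_def algebra_simps)

text \<open>
  The Lorentzian counterpart of the triple product expansion. It is what makes \<open>J p\<close> a complex
  structure on the tangent plane.
\<close>

lemma mcross_mcross: "mcross x (mcross y z) = mink x y *\<^sub>R z - mink x z *\<^sub>R y"
  by (rule vec3_eqI) (simp_all add: mink_def algebra_simps)

lemma mink_mcross_self: "mink x (mcross x y) = 0" "mink y (mcross x y) = 0"
  by (simp_all add: mink_def algebra_simps)

lemma mink_mcross_cycle: "mink (mcross x y) z = - mink y (mcross x z)"
  by (simp add: mink_def algebra_simps)

lemma J_tangent: "J p v \<in> tangent p"
  by (simp add: J_def tangent_def mink_mcross_self)

lemma mink_J: "p \<in> H2 \<Longrightarrow> v \<in> tangent p \<Longrightarrow> w \<in> tangent p \<Longrightarrow> mink (J p v) (J p w) = mink v w"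
  by (simp add: J_def mink_mcross H2_def tangent_def mink_commute[of v p])

lemma J_J: "p \<in> H2 \<Longrightarrow> v \<in> tangent p \<Longrightarrow> J p (J p v) = - v"
  by (simp add: J_def mcross_mcross H2_def tangent_def)

lemma tangent_combination:
  "v \<in> tangent p \<Longrightarrow> w \<in> tangent p \<Longrightarrow> a *\<^sub>R v + c *\<^sub>R w \<in> tangent p"
  "v \<in> tangent p \<Longrightarrow> w \<in> tangent p \<Longrightarrow> v + w \<in> tangent p"
  "v \<in> tangent p \<Longrightarrow> w \<in> tangent p \<Longrightarrow> v - w \<in> tangent p"
  "v \<in> tangent p \<Longrightarrow> a *\<^sub>R v \<in> tangent p"
  by (simp_all add: tangent_def mink_simps)

lemma H2_iff: "p \<in> H2 \<longleftrightarrow> p $ 1 > 0 \<and> (p $ 1)\<^sup>2 = 1 + (p $ 2)\<^sup>2 + (p $ 3)\<^sup>2"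
  by (auto simp: H2_def mink_def power2_eq_square)

text \<open>
  Quantitative form of the fact that tangent planes are spacelike: the relation
  \<open>mink p v = 0\<close> determines \<open>v $ 1\<close>, and the Lagrange identity in the last two coordinates
  bounds it. Both the positivity of \<open>mink\<close> on tangent planes and the fact that geodesics stay
  on the upper sheet follow from it.
\<close>

lemma tangent_first_component:
  assumes p: "p \<in> H2" and v: "v \<in> tangent p"
  shows "(v $ 1)\<^sup>2 \<le> ((p $ 1)\<^sup>2 - 1) * mink v v"
proof -
  have e: "p $ 1 * v $ 1 = p $ 2 * v $ 2 + p $ 3 * v $ 3"
    using v by (simp add: tangent_def mink_def)
  have pp: "(p $ 1)\<^sup>2 - 1 = (p $ 2)\<^sup>2 + (p $ 3)\<^sup>2" using p by (simp add: H2_iff)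
  have "(p $ 1 * v $ 1)\<^sup>2 + (p $ 2 * v $ 3 - p $ 3 * v $ 2)\<^sup>2
      = ((p $ 2)\<^sup>2 + (p $ 3)\<^sup>2) * ((v $ 2)\<^sup>2 + (v $ 3)\<^sup>2)"
    unfolding e by (simp add: power2_eq_square algebra_simps)
  then have "(p $ 1)\<^sup>2 * (v $ 1)\<^sup>2 \<le> ((p $ 2)\<^sup>2 + (p $ 3)\<^sup>2) * ((v $ 2)\<^sup>2 + (v $ 3)\<^sup>2)"
    by (smt (verit) power_mult_distrib zero_le_power2)
  then have "(p $ 1)\<^sup>2 * (v $ 1)\<^sup>2 \<le> ((p $ 1)\<^sup>2 - 1) * ((v $ 2)\<^sup>2 + (v $ 3)\<^sup>2)"
    by (simp add: pp)
  then show ?thesis by (simp add: mink_def power2_eq_square algebra_simps)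
qed

lemma mink_tangent_pos:
  assumes p: "p \<in> H2" and v: "v \<in> tangent p" and "v \<noteq> 0"
  shows "mink v v > 0"
proof (rule ccontr)
  assume n: "\<not> mink v v > 0"
  have "(p $ 1)\<^sup>2 - 1 \<ge> 0" using p by (simp add: H2_iff)
  then have "((p $ 1)\<^sup>2 - 1) * mink v v \<le> 0" using n by (simp add: mult_nonneg_nonpos)
  then have "v $ 1 = 0" using tangent_first_component[OF p v] by (smt (verit) zero_eq_power2 zero_le_power2)
  then have "(v $ 2)\<^sup>2 + (v $ 3)\<^sup>2 \<le> 0" using n by (simp add: mink_def power2_eq_square)
  then have "v $ 2 = 0 \<and> v $ 3 = 0" by (simp add: sum_power2_le_zero_iff)
  with \<open>v $ 1 = 0\<close> have "v = 0" by (intro vec3_eqI) auto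
  with assms show False by simp
qed

lemma mink_tangent_nonneg: "p \<in> H2 \<Longrightarrow> v \<in> tangent p \<Longrightarrow> mink v v \<ge> 0"
  using mink_tangent_pos[of p v] by (cases "v = 0") (auto simp: mink_def)

lemma gnorm_nonneg: "p \<in> H2 \<Longrightarrow> v \<in> tangent p \<Longrightarrow> gnorm v \<ge> 0"
  by (simp add: gnorm_def mink_tangent_nonneg)

lemma gnorm_power2: "p \<in> H2 \<Longrightarrow> v \<in> tangent p \<Longrightarrow> (gnorm v)\<^sup>2 = mink v v"
  by (simp add: gnorm_def mink_tangent_nonneg)

lemma mink_Cauchy_Schwarz:
  assumes p: "p \<in> H2" and v: "v \<in> tangent p" and w: "w \<in> tangent p"
  shows "\<bar>mink v w\<bar> \<le> gnorm v * gnorm w"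
proof (cases "w = 0")
  case True then show ?thesis by (simp add: mink_def gnorm_def)
next
  case False
  define q where "q = mink w w *\<^sub>R v - mink v w *\<^sub>R w"
  have ww: "mink w w > 0" by (rule mink_tangent_pos[OF p w False])
  have "mink q q \<ge> 0"
    by (rule mink_tangent_nonneg[OF p]) (simp add: q_def tangent_combination v w)
  moreover have "mink q q = mink w w * (mink v v * mink w w - (mink v w)\<^sup>2)"
    by (simp add: q_def mink_simps mink_commute[of w v] power2_eq_square algebra_simps)
  ultimately have "(mink v w)\<^sup>2 \<le> mink v v * mink w w"
    using ww by (simp add: zero_le_mult_iff)
  also have "\<dots> = (gnorm v * gnorm w)\<^sup>2"
    by (simp add: power_mult_distrib gnorm_power2[OF p] v w)
  finally have "\<bar>mink v w\<bar> \<le> \<bar>gnorm v * gnorm w\<bar>" by (simp only: abs_le_square_iff)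
  then show ?thesis using gnorm_nonneg[OF p v] gnorm_nonneg[OF p w] by (simp add: abs_mult)
qed

text \<open>
  The alternative \<open>gnorm v = 0\<close> covers negative \<open>K\<close>, for which the hypothesis forces \<open>v = 0\<close>.
\<close>

lemma gnorm_le_by_duality:
  assumes p: "p \<in> H2" and v: "v \<in> tangent p"
    and le: "\<And>w. w \<in> tangent p \<Longrightarrow> \<bar>mink v w\<bar> \<le> K * gnorm w"
  shows "gnorm v \<le> K \<or> gnorm v = 0"
proof -
  have "gnorm v * gnorm v \<le> K * gnorm v"
    using le[OF v] gnorm_power2[OF p v] by (simp add: power2_eq_square)
  then show ?thesis using gnorm_nonneg[OF p v] by (auto simp: mult_le_cancel_right)
qed

lemma gnorm_J: "p \<in> H2 \<Longrightarrow> v \<in> tangent p \<Longrightarrow> gnorm (J p v) = gnorm v"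
  by (simp add: gnorm_def mink_J)

lemma orthonormal_frame_exists:
  assumes p: "p \<in> H2"
  obtains e f where "orthonormal_frame p e f"
proof -
  define v :: "real^3" where "v = vector [p $ 2, p $ 1, 0]"
  define e where "e = (1 / gnorm v) *\<^sub>R v"
  have v: "v \<in> tangent p" by (simp add: v_def tangent_def mink_def)
  have "v \<noteq> 0"
  proof
    assume "v = 0"
    then have "v $ 2 = 0" by simp
    then show False using p by (simp add: v_def H2_iff)
  qed
  then have pos: "mink v v > 0" by (rule mink_tangent_pos[OF p v])
  have et: "e \<in> tangent p" by (simp add: e_def tangent_combination v)
  have ee: "mink e e = 1" using pos by (simp add: e_def mink_simps gnorm_def)
  have "orthonormal_frame p e (J p e)"
    by (simp add: orthonormal_frame_def et ee J_tangent mink_J[OF p et et])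
       (simp add: J_def mink_mcross_self)
  then show thesis by (rule that)
qed

text \<open>
  The residual \<open>r\<close> of the expansion is orthogonal to \<open>p\<close>, \<open>e\<close> and \<open>f\<close>. By Cramer's rule the
  determinant \<open>D\<close> of these three vectors annihilates \<open>r\<close>, and \<open>D\<^sup>2\<close> is minus their Gram
  determinant, hence \<open>1\<close>.
\<close>

lemma orthonormal_frame_expansion:
  assumes p: "p \<in> H2" and fr: "orthonormal_frame p e f" and v: "v \<in> tangent p"
  shows "v = mink v e *\<^sub>R e + mink v f *\<^sub>R f"
proof -
  define r where "r = v - (mink v e *\<^sub>R e + mink v f *\<^sub>R f)"
  define D where "D = mink (mcross p e) f"
  have pp: "mink p p = -1" and pe: "mink p e = 0" and pf: "mink p f = 0"
    and ee: "mink e e = 1" and ff: "mink f f = 1" and ef: "mink e f = 0" "mink f e = 0"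
    using p fr by (auto simp: H2_def orthonormal_frame_def tangent_def mink_commute[of f e])
  have rp: "mink p r = 0" "mink e r = 0" "mink f r = 0"
    using v by (simp_all add: r_def mink_simps pp pe pf ee ff ef tangent_def mink_commute[of _ v])
  have "mink (mcross p e) f *\<^sub>R r
      = mink p r *\<^sub>R mcross e f + mink e r *\<^sub>R mcross f p + mink f r *\<^sub>R mcross p e"
    by (rule vec3_eqI) (simp_all add: mink_def algebra_simps)
  then have "D *\<^sub>R r = 0" by (simp add: D_def rp)
  moreover have "D\<^sup>2 = - (mink p p * (mink e e * mink f f - mink e f * mink e f)
      - mink p e * (mink p e * mink f f - mink e f * mink p f)
      + mink p f * (mink p e * mink e f - mink e e * mink p f))"
    by (simp add: D_def mink_def power2_eq_square algebra_simps)
  then have "D\<^sup>2 = 1" by (simp add: pp pe pf ee ff ef)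
  then have "D \<noteq> 0" by auto
  ultimately have "r = 0" by simp
  then show ?thesis by (simp add: r_def)
qed

lemma orthonormal_frame_Parseval:
  assumes p: "p \<in> H2" and fr: "orthonormal_frame p e f"
    and v: "v \<in> tangent p" and w: "w \<in> tangent p"
  shows "mink v w = mink v e * mink w e + mink v f * mink w f"
proof -
  have "mink v w = mink (mink v e *\<^sub>R e + mink v f *\<^sub>R f) w"
    using orthonormal_frame_expansion[OF p fr v] by simp
  also have "\<dots> = mink v e * mink w e + mink v f * mink w f"
    by (simp only: mink_simps real_scaleR_def mink_commute[of w])
  finally show ?thesis .
qed

lemma trace_independent_of_frame:
  assumes p: "p \<in> H2" and fr: "orthonormal_frame p e f" and fr': "orthonormal_frame p e' f'"
    and B1: "\<And>w. linear (\<lambda>v. B v w)" and B2: "\<And>v. linear (B v)"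
  shows "B e' e' + B f' f' = (B e e + B f f :: real)"
proof -
  define a b c d where "a = mink e' e" "b = mink e' f" "c = mink f' e" "d = mink f' f"
  have t: "e \<in> tangent p" "f \<in> tangent p" "e' \<in> tangent p" "f' \<in> tangent p"
    and n: "mink e e = 1" "mink f f = 1" "mink e f = 0"
    using fr fr' by (auto simp: orthonormal_frame_def)
  have E: "e' = a *\<^sub>R e + b *\<^sub>R f" and F: "f' = c *\<^sub>R e + d *\<^sub>R f"
    using orthonormal_frame_expansion[OF p fr] t by (simp_all add: a_b_c_d_def)
  have 1: "a * a + c * c = 1" "b * b + d * d = 1" "a * b + c * d = 0"
    using orthonormal_frame_Parseval[OF p fr' t(1,1)] orthonormal_frame_Parseval[OF p fr' t(2,2)]
      orthonormal_frame_Parseval[OF p fr' t(1,2)]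
    by (simp_all add: a_b_c_d_def n mink_commute)
  have X: "B (x *\<^sub>R e + y *\<^sub>R f) (x *\<^sub>R e + y *\<^sub>R f)
      = x * x * B e e + x * y * (B e f + B f e) + y * y * B f f" for x y
    by (simp add: linear_add[OF B1] linear_add[OF B2] linear_scale[OF B1] linear_scale[OF B2]
        algebra_simps)
  have "B e' e' + B f' f' = (a * a + c * c) * B e e + (a * b + c * d) * (B e f + B f e)
      + (b * b + d * d) * B f f"
    unfolding E F X by (simp add: algebra_simps)
  then show ?thesis by (simp add: 1)
qed

section \<open>Integrals of powers of horospherical functions\<close>

text \<open>
  The vectors \<open>ray t\<close> span the light rays of the future cone, that is, the points of the circle
  at infinity. The functions \<open>horo x t\<close> are the exponentials of Busemann functions: their level
  sets on \<open>H2\<close> are the horocycles at the ideal point \<open>cis t\<close>.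
\<close>

definition ray :: "real \<Rightarrow> real^3" where
  "ray t = vector [1, cos t, sin t]"

definition horo :: "real^3 \<Rightarrow> real \<Rightarrow> real" where
  "horo x t = - mink x (ray t)"

text \<open>
  The open future cone is a neighbourhood of \<open>H2\<close> on which every \<open>horo\<close> is positive; its convexity
  is what differentiation under the integral sign and the constancy argument below rely on.
\<close>

definition timecone :: "(real^3) set" where
  "timecone = {x. norm (Complex (x $ 2) (x $ 3)) < x $ 1}"

definition horo_integral :: "(real \<Rightarrow> real) \<Rightarrow> nat \<Rightarrow> real^3 \<Rightarrow> real" where
  "horo_integral g k x = integral {0..2 * pi} (\<lambda>t. g t / horo x t ^ k)"

lemma horo_eq: "horo x t = x $ 1 - x $ 2 * cos t - x $ 3 * sin t"
  by (simp add: horo_def ray_def mink_def)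

lemma mink_ray_ray: "mink (ray t) (ray t) = 0"
  by (simp add: mink_def ray_def power2_eq_square[symmetric] sin_squared_eq)

lemma horo_linear:
  "horo (x + y) t = horo x t + horo y t" "horo (x - y) t = horo x t - horo y t"
  "horo (a *\<^sub>R x) t = a * horo x t"
  by (simp_all add: horo_def mink_simps)

lemma continuous_on_horo: "continuous_on S (\<lambda>z. horo (fst z) (snd z))" "continuous_on T (horo x)"
  unfolding horo_eq by (intro continuous_intros)+

lemma horo_pos:
  assumes "x \<in> timecone"
  shows "horo x t > 0"
proof -
  have "Complex (x $ 2) (x $ 3) \<bullet> cis t \<le> norm (Complex (x $ 2) (x $ 3)) * norm (cis t)"
    by (rule norm_cauchy_schwarz)
  also have "\<dots> < x $ 1" using assms by (simp add: timecone_def)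
  finally show ?thesis by (simp add: horo_eq inner_complex_def)
qed

lemma horo_nonzero: "x \<in> timecone \<Longrightarrow> horo x t \<noteq> 0"
  using horo_pos[of x t] by simp

lemma open_timecone: "open timecone"
  unfolding timecone_def cmod_def complex.sel by (intro open_Collect_less continuous_intros)

lemma convex_timecone: "convex timecone"
proof (rule convexI)
  fix x y :: "real^3" and u v :: real
  assume x: "x \<in> timecone" and y: "y \<in> timecone" and uv: "0 \<le> u" "0 \<le> v" "u + v = 1"
  let ?c = "\<lambda>x::real^3. Complex (x $ 2) (x $ 3)"
  have "?c (u *\<^sub>R x + v *\<^sub>R y) = u *\<^sub>R ?c x + v *\<^sub>R ?c y"
    by (simp add: complex_eq_iff)
  then have "norm (?c (u *\<^sub>R x + v *\<^sub>R y)) \<le> u * norm (?c x) + v * norm (?c y)"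
    using uv norm_triangle_ineq[of "u *\<^sub>R ?c x" "v *\<^sub>R ?c y"] by simp
  also have "\<dots> < u * x $ 1 + v * y $ 1"
  proof (cases "u = 0")
    case True then show ?thesis using y uv by (simp add: timecone_def)
  next
    case False
    then have "u * norm (?c x) < u * x $ 1" using x uv by (simp add: timecone_def)
    moreover have "v * norm (?c y) \<le> v * y $ 1"
      using y uv by (intro mult_left_mono) (auto simp: timecone_def)
    ultimately show ?thesis by linarith
  qed
  finally show "u *\<^sub>R x + v *\<^sub>R y \<in> timecone" by (simp add: timecone_def)
qed

lemma mink_neg_timecone:
  assumes "x \<in> timecone" shows "mink x x < 0"
proof -
  have "(norm (Complex (x $ 2) (x $ 3)))\<^sup>2 < (x $ 1)\<^sup>2"
    using assms by (intro power_strict_mono) (auto simp: timecone_def)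
  then show ?thesis by (simp add: cmod_def mink_def power2_eq_square)
qed

lemma H2_subset_timecone: "H2 \<subseteq> timecone"
proof
  fix p assume p: "p \<in> H2"
  then have "sqrt ((p $ 2)\<^sup>2 + (p $ 3)\<^sup>2) < sqrt ((p $ 1)\<^sup>2)"
    by (intro real_sqrt_less_mono) (simp add: H2_iff)
  then show "p \<in> timecone" using p by (simp add: timecone_def cmod_def H2_iff)
qed

lemma horo_integrand_integrable:
  assumes "continuous_on {0..2 * pi} g" "x \<in> timecone"
  shows "(\<lambda>t. g t / horo x t ^ k) integrable_on {0..2 * pi}"
  by (intro integrable_continuous_real continuous_intros assms continuous_on_horo)
     (simp add: horo_nonzero[OF assms(2)])

lemma horo_integral_simps:
  assumes "continuous_on {0..2 * pi} g" "continuous_on {0..2 * pi} h" "x \<in> timecone"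
  shows "horo_integral (\<lambda>t. g t + h t) k x = horo_integral g k x + horo_integral h k x"
    and "horo_integral (\<lambda>t. g t - h t) k x = horo_integral g k x - horo_integral h k x"
    and "horo_integral (\<lambda>t. a * g t) k x = a * horo_integral g k x"
  using integral_add[OF horo_integrand_integrable[OF assms(1,3)] horo_integrand_integrable[OF assms(2,3)], of k k]
    integral_diff[OF horo_integrand_integrable[OF assms(1,3)] horo_integrand_integrable[OF assms(2,3)], of k k]
    integral_mult_right[of "{0..2*pi}" a "\<lambda>t. g t / horo x t ^ k"]
  by (simp_all add: horo_integral_def add_divide_distrib diff_divide_distrib)

lemma horo_integral_mono:
  assumes "continuous_on {0..2 * pi} g" "continuous_on {0..2 * pi} h" "x \<in> timecone"
    and "\<And>t. g t \<le> h t"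
  shows "horo_integral g k x \<le> horo_integral h k x"
  unfolding horo_integral_def
  by (intro integral_le horo_integrand_integrable assms divide_right_mono)
     (use horo_pos[OF assms(3)] in \<open>simp add: less_imp_le\<close>)

lemma has_real_derivative_const_divide_power:
  assumes "y \<noteq> (0::real)"
  shows "((\<lambda>y. c / y ^ k) has_real_derivative (- real k * c / y ^ Suc k)) (at y)"
proof (cases k)
  case (Suc m)
  have "y ^ (m - 1) * real m * y = real m * y ^ m" by (cases m) auto
  then show ?thesis unfolding Suc using assms
    by (auto intro!: derivative_eq_intros simp: field_simps)
qed auto

text \<open>
  Because \<open>horo x t\<close> is linear in \<open>x\<close>, differentiating in direction \<open>v\<close> only multiplies the density
  by \<open>- k * horo v t\<close> and raises the exponent. The class of these integrals is thus closed under
  differentiation, which makes all of them smooth.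
\<close>

lemma has_derivative_horo_integral:
  assumes g: "continuous_on {0..2 * pi} g" and x: "x \<in> timecone"
  shows "(horo_integral g k has_derivative
      (\<lambda>v. horo_integral (\<lambda>t. (- real k * g t) * horo v t) (Suc k) x)) (at x)"
proof -
  \<comment> \<open>The evaluation \<open>v \<mapsto> horo v t\<close> is written in the coordinate functionals so that its
    continuity in \<open>t\<close>, as a bounded linear map, is visible.\<close>
  define E where "E i = Blinfun (\<lambda>v::real^3. v $ i)" for i
  have E: "blinfun_apply (E i) v = v $ i" for i v
    unfolding E_def by (simp add: bounded_linear_Blinfun_apply bounded_linear_vec_nth)
  define H where "H t = E 1 - cos t *\<^sub>R E 2 - sin t *\<^sub>R E 3" for t
  have H: "blinfun_apply (H t) v = horo v t" for t v
    by (simp add: H_def E blinfun.diff_left blinfun.scaleR_left horo_eq mult.commute)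
  define D where "D y t = (- real k * g t / horo y t ^ Suc k) *\<^sub>R H t" for y t
  have D: "blinfun_apply (D y t) v = (- real k * g t) * horo v t / horo y t ^ Suc k" for y t v
    by (simp only: D_def H blinfun.scaleR_left real_scaleR_def times_divide_eq_left)
  have pos: "horo y t \<noteq> 0" if "y \<in> timecone" for y t
    using horo_pos[OF that, of t] by simp
  have cg: "continuous_on (timecone \<times> cbox 0 (2 * pi)) (\<lambda>z. g (snd z))"
    by (rule continuous_on_compose2[OF g]) (auto intro: continuous_intros)
  have "((\<lambda>y. integral (cbox 0 (2 * pi)) (\<lambda>t. g t / horo y t ^ k)) has_derivative
      integral (cbox 0 (2 * pi)) (D x)) (at x within timecone)"
  proof (rule leibniz_rule)
    fix y t assume y: "y \<in> timecone"
    have "((\<lambda>y. horo y t) has_derivative (\<lambda>v. horo v t)) (at y within timecone)"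
      using bounded_linear_imp_has_derivative[OF blinfun.bounded_linear_right[of "H t"]]
      by (simp add: H)
    from has_derivative_compose[OF this
        has_real_derivative_const_divide_power[OF pos[OF y, of t], of "g t" k, unfolded has_field_derivative_def]]
    show "((\<lambda>y. g t / horo y t ^ k) has_derivative blinfun_apply (D y t)) (at y within timecone)"
      by (rule has_derivative_eq_rhs) (auto simp: D fun_eq_iff)
  next
    fix y assume "y \<in> timecone"
    then show "(\<lambda>t. g t / horo y t ^ k) integrable_on cbox 0 (2 * pi)"
      using horo_integrand_integrable[OF g] by (simp add: cbox_interval)
  next
    show "continuous_on (timecone \<times> cbox 0 (2 * pi)) (\<lambda>(y, t). D y t)"
      unfolding D_def H_def case_prod_beta
      by (intro continuous_intros cg continuous_on_horo) (auto simp: pos)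
  qed (use x convex_timecone in auto)
  moreover have "blinfun_apply (integral (cbox 0 (2 * pi)) (D x)) v
      = horo_integral (\<lambda>t. (- real k * g t) * horo v t) (Suc k) x" for v
  proof -
    have "continuous_on (cbox 0 (2 * pi)) (D x)"
      unfolding D_def H_def
      by (intro continuous_intros continuous_on_horo g[folded cbox_interval]) (auto simp: pos[OF x])
    from blinfun_apply_integral[OF integrable_continuous[OF this], of v]
    show ?thesis by (simp add: horo_integral_def D cbox_interval del: power_Suc)
  qed
  ultimately have "((\<lambda>y. integral (cbox 0 (2 * pi)) (\<lambda>t. g t / horo y t ^ k)) has_derivative
      (\<lambda>v. horo_integral (\<lambda>t. (- real k * g t) * horo v t) (Suc k) x)) (at x within timecone)"
    by (auto intro: has_derivative_eq_rhs)
  then show ?thesis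
    by (simp only: at_within_open[OF x open_timecone] horo_integral_def[abs_def] cbox_interval)
qed

lemma Ck_on_horo_integral:
  assumes "continuous_on {0..2 * pi} g"
  shows "Ck_on n timecone (horo_integral g k)"
  using assms
proof (induction n arbitrary: g k)
  case 0
  then have "continuous (at x) (horo_integral g k)" if "x \<in> timecone" for x
    using has_derivative_horo_integral[of g x k] has_derivative_continuous that by blast
  then show ?case by (simp add: continuous_at_imp_continuous_on)
next
  case (Suc n)
  show ?case unfolding Ck_on.simps
    by (intro exI[of _ "\<lambda>x v. horo_integral (\<lambda>t. (- real k * g t) * horo v t) (Suc k) x"]
        conjI ballI allI has_derivative_horo_integral Suc.IH continuous_intros continuous_on_horo
        Suc.prems)
qed

text \<open>
  The integrand is the \<open>t\<close>-derivative of the periodic function \<open>horo w t / horo x t\<close>: the Wronskian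
  of two trigonometric polynomials \<open>horo w\<close> and \<open>horo x\<close> is again one, namely that of
  \<open>mcross w x\<close>.
\<close>

lemma horo_integral_mcross:
  assumes x: "x \<in> timecone"
  shows "horo_integral (horo (mcross w x)) 2 x = 0"
proof -
  have "((\<lambda>t. horo w t / horo x t) has_real_derivative horo (mcross w x) t / (horo x t)\<^sup>2)
      (at t within {0..2 * pi})" for t
  proof -
    have h: "((\<lambda>t. horo y t) has_real_derivative (y $ 2 * sin t - y $ 3 * cos t))
        (at t within {0..2 * pi})" for y :: "real^3"
      unfolding horo_eq by (auto intro!: derivative_eq_intros)
    have "((\<lambda>t. horo w t / horo x t) has_real_derivative
       ((w $ 2 * sin t - w $ 3 * cos t) * horo x t - horo w t * (x $ 2 * sin t - x $ 3 * cos t))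
        / (horo x t * horo x t)) (at t within {0..2 * pi})"
      using horo_pos[OF x, of t] by (intro DERIV_divide h) simp
    moreover have "(w $ 2 * sin t - w $ 3 * cos t) * horo x t - horo w t * (x $ 2 * sin t - x $ 3 * cos t)
       = (w $ 3 * x $ 2 - w $ 2 * x $ 3) * (sin t * sin t + cos t * cos t)
         - (w $ 3 * x $ 1 - w $ 1 * x $ 3) * cos t - (w $ 1 * x $ 2 - w $ 2 * x $ 1) * sin t"
      unfolding horo_eq by algebra
    moreover have "sin t * sin t + cos t * cos t = 1"
      using sin_cos_squared_add[of t] by (simp add: power2_eq_square)
    ultimately show ?thesis by (simp add: horo_eq power2_eq_square)
  qed
  then have "((\<lambda>t. horo (mcross w x) t / (horo x t)\<^sup>2) has_integral
      horo w (2 * pi) / horo x (2 * pi) - horo w 0 / horo x 0) {0..2 * pi}"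
    by (intro fundamental_theorem_of_calculus)
       (auto simp: has_real_derivative_iff_has_vector_derivative)
  then show ?thesis
    by (simp add: horo_integral_def horo_eq integral_unique)
qed

text \<open>
  A vector \<open>v\<close> splits into a multiple of \<open>x\<close> and a vector of the form \<open>mcross w x\<close>; the
  latter contributes nothing. By the triple product expansion \<open>w\<close> is a multiple of
  \<open>mcross x v\<close>.
\<close>

lemma horo_integral_linear_balance:
  assumes x: "x \<in> timecone"
  shows "- mink x x * horo_integral (horo v) 2 x = - mink x v * horo_integral (\<lambda>_. 1) 1 x"
proof -
  have m: "mcross (mcross x v) x = (- mink x x) *\<^sub>R v + mink x v *\<^sub>R x"
    by (rule vec3_eqI) (simp_all add: mink_def algebra_simps)
  have "(0::real) = horo_integral (\<lambda>t. - mink x x * horo v t + mink x v * horo x t) 2 x"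
    using horo_integral_mcross[OF x, of "mcross x v"] unfolding m horo_linear[abs_def] by simp
  also have "\<dots> = - mink x x * horo_integral (horo v) 2 x + mink x v * horo_integral (horo x) 2 x"
    using x by (subst horo_integral_simps(1))
      (simp_all only: horo_integral_simps(3)[OF continuous_on_horo(2) continuous_on_horo(2)]
        continuous_on_horo continuous_on_mult continuous_on_const)
  also have "horo_integral (horo x) 2 x = horo_integral (\<lambda>_. 1) 1 x"
    unfolding horo_integral_def
    by (intro integral_cong) (simp add: power2_eq_square horo_nonzero[OF x])
  finally show ?thesis by simp
qed

text \<open>
  By the previous balance the product has derivative zero, so it is constant on the cone, and at
  \<open>(1, 0, 0)\<close>, where \<open>horo\<close> is identically \<open>1\<close>, it equals \<open>2 * pi\<close>.
\<close>

lemma horo_integral_inverse: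
  assumes x: "x \<in> timecone"
  shows "horo_integral (\<lambda>_. 1) 1 x * sqrt (- mink x x) = 2 * pi"
proof -
  let ?I = "horo_integral (\<lambda>_. 1) 1"
  have "((\<lambda>x. ?I x * sqrt (- mink x x)) has_derivative (\<lambda>v. 0)) (at y within timecone)"
    if y: "y \<in> timecone" for y
  proof -
    let ?q = "- mink y y"
    have q: "?q > 0" using mink_neg_timecone[OF y] by simp
    have "((\<lambda>y. - mink y y) has_derivative (\<lambda>v. - (mink y v + mink v y))) (at y)"
      by (intro has_derivative_minus bounded_bilinear.FDERIV[OF bounded_bilinear_mink] has_derivative_ident)
    from has_derivative_real_sqrt[OF q this]
    have s: "((\<lambda>y. sqrt (- mink y y)) has_derivative (\<lambda>v. - mink y v / sqrt ?q)) (at y)"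
      by (rule has_derivative_eq_rhs) (use q in \<open>auto simp: fun_eq_iff mink_commute divide_simps\<close>)
    have d: "(?I has_derivative (\<lambda>v. mink y v * ?I y / ?q)) (at y)"
    proof (rule has_derivative_eq_rhs[OF has_derivative_horo_integral[OF _ y]])
      have "horo_integral (\<lambda>t. (- real 1 * 1) * horo v t) (Suc 1) y = mink y v * ?I y / ?q" for v
      proof -
        have "horo_integral (\<lambda>t. - 1 * horo v t) 2 y = - 1 * horo_integral (horo v) 2 y"
          by (rule horo_integral_simps(3)) (auto intro: continuous_on_horo y)
        then show ?thesis
          using horo_integral_linear_balance[OF y, of v] q by (simp add: field_simps numeral_2_eq_2)
      qed
      then show "(\<lambda>v. horo_integral (\<lambda>t. (- real 1 * 1) * horo v t) (Suc 1) y) = (\<lambda>v. mink y v * ?I y / ?q)"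
        by blast
    qed auto
    have "((\<lambda>x. ?I x * sqrt (- mink x x)) has_derivative
        (\<lambda>v. ?I y * (- mink y v / sqrt ?q) + mink y v * ?I y / ?q * sqrt ?q)) (at y)"
      by (rule has_derivative_mult[OF d s])
    moreover have "?I y * (- mink y v / sqrt ?q) + mink y v * ?I y / ?q * sqrt ?q = 0" for v
    proof -
      have "sqrt ?q / ?q = 1 / sqrt ?q" using q by (simp add: real_div_sqrt field_simps)
      then have "mink y v * ?I y / ?q * sqrt ?q = mink y v * ?I y * (1 / sqrt ?q)"
        by (metis times_divide_eq_left times_divide_eq_right)
      then show ?thesis by simp
    qed
    ultimately show ?thesis by (simp add: has_derivative_at_withinI)
  qed
  from has_derivative_zero_constant[OF convex_timecone this]
  obtain c where c: "\<And>y. y \<in> timecone \<Longrightarrow> ?I y * sqrt (- mink y y) = c"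
    by blast
  define z :: "real^3" where "z = vector [1, 0, 0]"
  have "z \<in> timecone" by (simp add: z_def timecone_def cmod_def)
  moreover have "?I z = 2 * pi" by (simp add: horo_integral_def horo_eq z_def)
  moreover have "mink z z = -1" by (simp add: z_def mink_def)
  ultimately have "c = 2 * pi" using c[of z] by simp
  then show ?thesis using c[OF x] by simp
qed

text \<open>
  The kernel \<open>horo p t powr (-2)\<close>, normalised by \<open>2 * pi\<close>, reproduces linear functions on \<open>H2\<close> from
  their boundary densities. In the disk this is the statement that it reproduces affine functions.
\<close>

lemma horo_integral_linear:
  assumes p: "p \<in> H2"
  shows "horo_integral (horo c) 2 p = - 2 * pi * mink p c"
proof -
  have x: "p \<in> timecone" using p H2_subset_timecone by blast
  have pp: "mink p p = -1" using p by (simp add: H2_def)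
  show ?thesis
    using horo_integral_linear_balance[OF x, of c] horo_integral_inverse[OF x] by (simp add: pp)
qed

section \<open>Gradient, Hessian and Laplacian through an extension\<close>

text \<open>
  Functions on \<open>H2\<close> are differentiated through an extension \<open>F\<close> to a neighbourhood. The second
  argument of \<open>F''\<close> is the one already inserted into \<open>F'\<close>, the last one is the direction of the
  second differentiation; this order reappears in the formula for the Hessian.
\<close>

locale C2_extension =
  fixes u :: "real^3 \<Rightarrow> real" and U :: "(real^3) set"
    and F :: "real^3 \<Rightarrow> real" and F' :: "real^3 \<Rightarrow> real^3 \<Rightarrow> real"
    and F'' :: "real^3 \<Rightarrow> real^3 \<Rightarrow> real^3 \<Rightarrow> real"
  assumes open_U: "open U" and H2_subset: "H2 \<subseteq> U"
    and extends: "\<And>x. x \<in> H2 \<Longrightarrow> F x = u x"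
    and first: "\<And>x. x \<in> U \<Longrightarrow> (F has_derivative F' x) (at x)"
    and second: "\<And>x v. x \<in> U \<Longrightarrow> ((\<lambda>y. F' y v) has_derivative F'' x v) (at x)"

definition mink_dual :: "(real^3 \<Rightarrow> real) \<Rightarrow> real^3" where
  "mink_dual L = vector [- L (axis 1 1), L (axis 2 1), L (axis 3 1)]"

lemma mink_mink_dual:
  assumes "linear L"
  shows "mink (mink_dual L) v = L v"
proof -
  have "v = v $ 1 *\<^sub>R axis 1 1 + v $ 2 *\<^sub>R axis 2 1 + v $ 3 *\<^sub>R axis 3 1"
    by (rule vec3_eqI) (simp_all add: axis_def)
  then have "L v = L (v $ 1 *\<^sub>R axis 1 1 + v $ 2 *\<^sub>R axis 2 1 + v $ 3 *\<^sub>R axis 3 1)" by simp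
  also have "\<dots> = v $ 1 * L (axis 1 1) + v $ 2 * L (axis 2 1) + v $ 3 * L (axis 3 1)"
    by (simp add: linear_add[OF assms] linear_scale[OF assms])
  finally show ?thesis by (simp add: mink_dual_def mink_def algebra_simps)
qed

context C2_extension
begin

lemma linear_F': "x \<in> U \<Longrightarrow> linear (F' x)"
  using first has_derivative_linear by blast

lemma dH_u:
  assumes "p \<in> H2" "v \<in> tangent p"
  shows "dH u p v = F' p v"
proof (rule dH_eq[OF assms])
  show "(u has_derivative F' p) (at p within H2)"
    by (rule has_derivative_transform[OF _ extends[symmetric] has_derivative_at_withinI[OF first]])
       (use assms(1) H2_subset in auto)
qed

lemma grad_eq:
  assumes p: "p \<in> H2"
  shows "grad u p = tproj p (mink_dual (F' p))"
  unfolding grad_def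
proof (rule the_equality)
  have L: "linear (F' p)" using linear_F' p H2_subset by blast
  show *: "tproj p (mink_dual (F' p)) \<in> tangent p \<and>
      (\<forall>v\<in>tangent p. mink (tproj p (mink_dual (F' p))) v = dH u p v)"
    using p by (simp add: tproj_tangent mink_tproj mink_mink_dual[OF L] dH_u)
  fix w assume w: "w \<in> tangent p \<and> (\<forall>v\<in>tangent p. mink w v = dH u p v)"
  define d where "d = w - tproj p (mink_dual (F' p))"
  have d: "d \<in> tangent p" using w * by (simp add: d_def tangent_combination)
  then have "mink d d = 0" using w * by (simp add: d_def mink_simps)
  then have "d = 0" using mink_tangent_pos[OF p d] by auto
  then show "w = tproj p (mink_dual (F' p))" by (simp add: d_def)
qed

lemma grad_has_derivative:
  assumes p: "p \<in> H2"
  obtains c where "(grad u has_derivative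
    (\<lambda>v. mink_dual (\<lambda>w. F'' p w v) + c v *\<^sub>R p + F' p p *\<^sub>R v)) (at p within H2)"
proof -
  have pU: "p \<in> U" using p H2_subset by blast
  let ?G = "\<lambda>x. mink_dual (F' x)" and ?G' = "\<lambda>v. mink_dual (\<lambda>w. F'' p w v)"
  have G: "(?G has_derivative ?G') (at p)"
  proof -
    have e: "mink_dual L = (- L (axis 1 1)) *\<^sub>R axis 1 1 + L (axis 2 1) *\<^sub>R axis 2 1
        + L (axis 3 1) *\<^sub>R axis 3 1" for L
      by (rule vec3_eqI) (simp_all add: mink_dual_def axis_def)
    show ?thesis unfolding e
      by (intro has_derivative_add has_derivative_scaleR_left has_derivative_minus second[OF pU])
  qed
  have "((\<lambda>x. ?G x + mink (?G x) x *\<^sub>R x) has_derivative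
      (\<lambda>v. ?G' v + (mink (?G p) p *\<^sub>R v + (mink (?G p) v + mink (?G' v) p) *\<^sub>R p))) (at p)"
    by (intro has_derivative_add G has_derivative_scaleR has_derivative_ident
        bounded_bilinear.FDERIV[OF bounded_bilinear_mink])
  then have d: "((\<lambda>x. tproj x (?G x)) has_derivative
      (\<lambda>v. ?G' v + (mink (?G p) v + mink (?G' v) p) *\<^sub>R p + F' p p *\<^sub>R v)) (at p within H2)"
    unfolding tproj_def
    by (rule has_derivative_at_withinI[OF has_derivative_eq_rhs])
       (rule ext, simp only: mink_mink_dual[OF linear_F'[OF pU]] add_ac)
  show thesis
    by (rule that[OF has_derivative_transform[OF p grad_eq d]])
qed

lemma grad_tangent: "p \<in> H2 \<Longrightarrow> grad u p \<in> tangent p"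
  by (simp add: grad_eq tproj_tangent)

lemma grad_differentiable: "p \<in> H2 \<Longrightarrow> grad u differentiable (at p within H2)"
  by (meson differentiable_def grad_has_derivative)

text \<open>
  The intrinsic Hessian differs from the ambient one by the second fundamental form of the
  hyperboloid, which is the metric times the position vector. For a linear \<open>F\<close> the ambient Hessian
  vanishes and \<open>F' p p = F p\<close>, so such functions satisfy \<open>Hess u = u g\<close>.
\<close>

lemma Hess_eq:
  assumes p: "p \<in> H2" and v: "v \<in> tangent p" and w: "w \<in> tangent p"
  shows "Hess u p v w = F'' p w v + F' p p * mink v w"
proof -
  obtain c where c: "(grad u has_derivative
      (\<lambda>v. mink_dual (\<lambda>w. F'' p w v) + c v *\<^sub>R p + F' p p *\<^sub>R v)) (at p within H2)"
    by (rule grad_has_derivative[OF p])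
  have pU: "p \<in> U" using p H2_subset by blast
  have L: "linear (\<lambda>w. F'' p w v)"
  proof (rule linearI)
    fix a b
    have "((\<lambda>x. F' x (a + b)) has_derivative (\<lambda>z. F'' p a z + F'' p b z)) (at p)"
      by (rule has_derivative_transform_within_open[OF has_derivative_add[OF second[OF pU] second[OF pU]] open_U pU])
         (simp add: linear_add[OF linear_F'])
    from has_derivative_unique[OF second[OF pU] this] show "F'' p (a + b) v = F'' p a v + F'' p b v"
      by meson
  next
    fix r a
    have "((\<lambda>x. F' x (r *\<^sub>R a)) has_derivative (\<lambda>z. r * F'' p a z)) (at p)"
      by (rule has_derivative_transform_within_open[OF has_derivative_mult_right[OF second[OF pU]] open_U pU])
         (simp add: linear_scale[OF linear_F'])
    from has_derivative_unique[OF second[OF pU] this] show "F'' p (r *\<^sub>R a) v = r *\<^sub>R F'' p a v"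
      by (metis real_scaleR_def)
  qed
  have "Hess u p v w = mink (dH (grad u) p v) w"
    by (simp add: Hess_def nabla_def mink_tproj[OF w])
  also have "\<dots> = F'' p w v + F' p p * mink v w"
    using w by (simp add: dH_eq[OF p v c] mink_simps mink_mink_dual[OF L] tangent_def)
  finally show ?thesis .
qed

lemma laplacian_eq:
  assumes p: "p \<in> H2" and fr: "orthonormal_frame p e f"
  shows "laplacian u p = Hess u p e e + Hess u p f f"
proof -
  have "linear (nabla (grad u) p)" by (rule nabla_linear_direction[OF grad_differentiable[OF p]])
  then have B: "linear (\<lambda>v. Hess u p v w)" "linear (Hess u p v)" for v w
    unfolding Hess_def
    by (auto intro!: linearI simp: linear_add linear_scale mink_simps)
  show ?thesis unfolding laplacian_def
  proof (rule the_equality)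
    show "\<exists>e' f'. orthonormal_frame p e' f' \<and>
        Hess u p e e + Hess u p f f = Hess u p e' e' + Hess u p f' f'"
      using fr by blast
  next
    fix t assume "\<exists>e' f'. orthonormal_frame p e' f' \<and> t = Hess u p e' e' + Hess u p f' f'"
    then obtain e' f' where fr': "orthonormal_frame p e' f'"
      and t: "t = Hess u p e' e' + Hess u p f' f'"
      by blast
    show "t = Hess u p e e + Hess u p f f"
      unfolding t by (rule trace_independent_of_frame[OF p fr fr' B])
  qed
qed

text \<open>
  The complex structure is parallel: \<open>J x\<close> depends on \<open>x\<close> linearly, and the extra term
  \<open>mcross v (grad u p)\<close> of the product rule, a product of two tangent vectors, is normal.
\<close>

lemma nabla_rotated_gradient:
  assumes p: "p \<in> H2" and v: "v \<in> tangent p"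
    and V: "\<And>x. x \<in> H2 \<Longrightarrow> V x = J x (grad u x)"
  shows "nabla V p v = J p (nabla (grad u) p v)"
proof -
  note D = has_derivative_dH[OF grad_differentiable[OF p]]
  have "((\<lambda>x. mcross x (grad u x)) has_derivative
      (\<lambda>v. mcross p (dH (grad u) p v) + mcross v (grad u p))) (at p within H2)"
    by (rule bounded_bilinear.FDERIV[OF bounded_bilinear_mcross has_derivative_ident D])
  then have "dH V p v = mcross p (dH (grad u) p v) + mcross v (grad u p)"
    by (rule dH_eq[OF p v has_derivative_transform[OF p], rotated]) (simp add: V J_def)
  moreover have "tproj p (mcross v (grad u p)) = 0"
  proof -
    let ?y = "tproj p (mcross v (grad u p))"
    have t: "?y \<in> tangent p" by (rule tproj_tangent[OF p])
    have "mcross p (mcross v (grad u p)) = 0"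
      using v grad_tangent[OF p] by (simp add: mcross_mcross tangent_def)
    then have "mcross p ?y = 0"
      by (simp add: tproj_def bounded_bilinear.add_right[OF bounded_bilinear_mcross]
          bounded_bilinear.scaleR_right[OF bounded_bilinear_mcross])
         (simp add: vec_eq_iff forall_3)
    then show ?thesis using J_J[OF p t] by (simp add: J_def vec_eq_iff forall_3)
  qed
  moreover have "tproj p (mcross p y) = mcross p (tproj p y)" for y
  proof -
    have "mcross p p = 0" by (simp add: vec_eq_iff forall_3)
    then have "mcross p (tproj p y) = mcross p y"
      by (simp add: tproj_def bounded_bilinear.add_right[OF bounded_bilinear_mcross]
          bounded_bilinear.scaleR_right[OF bounded_bilinear_mcross])
    then show ?thesis using tproj_id[OF J_tangent[of p y]] by (simp add: J_def)
  qed
  ultimately show ?thesis by (simp add: nabla_def tproj_add J_def)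
qed

end

lemma smooth_on_H2_C2_extension:
  assumes "smooth_on_H2 u"
  obtains U F F' F'' where "C2_extension u U F F' F''"
proof -
  obtain U F where U: "open U" "H2 \<subseteq> U" "Ck_on 2 U F" "\<And>x. x \<in> H2 \<Longrightarrow> F x = u x"
    using assms unfolding smooth_on_H2_def by blast
  from U(3)[unfolded numeral_2_eq_2, THEN Ck_on.simps(2)[THEN iffD1]]
  obtain F' where F': "\<And>x. x \<in> U \<Longrightarrow> (F has_derivative F' x) (at x)"
      "\<And>v. Ck_on (Suc 0) U (\<lambda>x. F' x v)"
    by blast
  have "\<exists>G. \<forall>x\<in>U. (f has_derivative G x) (at x)" if "Ck_on (Suc 0) U f" for f
    using that unfolding Ck_on.simps(2) by (elim exE conjE) (rule exI)
  then have "\<forall>v. \<exists>G. \<forall>x\<in>U. ((\<lambda>y. F' y v) has_derivative G x) (at x)"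
    using F'(2) by simp
  then obtain G where "\<And>v x. x \<in> U \<Longrightarrow> ((\<lambda>y. F' y v) has_derivative G v x) (at x)"
    by metis
  then have "C2_extension u U F F' (\<lambda>x v. G v x)"
    using U F' by unfold_locales auto
  then show thesis by (rule that)
qed

section \<open>The maximum principle\<close>

definition geodesic :: "real^3 \<Rightarrow> real^3 \<Rightarrow> real \<Rightarrow> real^3" where
  "geodesic p e t = cosh t *\<^sub>R p + sinh t *\<^sub>R e"

lemma geodesic_in_H2:
  assumes p: "p \<in> H2" and e: "e \<in> tangent p" "mink e e = 1"
  shows "geodesic p e t \<in> H2"
proof -
  have "(e $ 1)\<^sup>2 < (p $ 1)\<^sup>2" using tangent_first_component[OF p e(1)] e(2) by simp
  then have "\<bar>e $ 1\<bar> < p $ 1" using p power2_less_imp_less[of "\<bar>e $ 1\<bar>" "p $ 1"] by (simp add: H2_iff)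
  moreover have "\<bar>sinh t\<bar> < cosh t"
    using cosh_square_eq[of t] cosh_real_pos[of t] power2_less_imp_less[of "\<bar>sinh t\<bar>" "cosh t"]
    by simp
  ultimately have "\<bar>sinh t\<bar> * \<bar>e $ 1\<bar> < cosh t * p $ 1"
    by (intro mult_strict_mono') auto
  then have "\<bar>sinh t * e $ 1\<bar> < cosh t * p $ 1" by (simp add: abs_mult)
  then have "geodesic p e t $ 1 > 0" by (simp add: geodesic_def)
  moreover have "mink (geodesic p e t) (geodesic p e t) = (sinh t)\<^sup>2 - (cosh t)\<^sup>2"
    using p e by (simp add: geodesic_def mink_simps H2_def tangent_def mink_commute[of e p] power2_eq_square)
  ultimately show ?thesis by (simp add: H2_def cosh_square_eq)
qed

lemma (in C2_extension) second_derivative_along_geodesic: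
  assumes p: "p \<in> H2" and e: "e \<in> tangent p" "mink e e = 1"
  obtains g' where "\<And>t. ((\<lambda>t. u (geodesic p e t)) has_real_derivative g' t) (at t)"
    and "(g' has_real_derivative Hess u p e e) (at 0)"
proof -
  let ?c = "geodesic p e"
  define g' where "g' t = sinh t * F' (?c t) p + cosh t * F' (?c t) e" for t
  have c: "(?c has_derivative (\<lambda>h. h *\<^sub>R (sinh t *\<^sub>R p + cosh t *\<^sub>R e))) (at t)" for t
    unfolding geodesic_def
    by (auto intro!: derivative_eq_intros simp: fun_eq_iff scaleR_add_right mult.commute)
  have cU: "?c t \<in> U" for t using geodesic_in_H2[OF p e] H2_subset by blast
  have "((\<lambda>t. F (?c t)) has_real_derivative g' t) (at t)" for t
    unfolding has_field_derivative_def
    by (rule has_derivative_eq_rhs[OF has_derivative_compose[OF c first[OF cU]]])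
       (simp add: fun_eq_iff g'_def linear_scale[OF linear_F'[OF cU]] linear_add[OF linear_F'[OF cU]]
         mult.commute)
  then have 1: "((\<lambda>t. u (?c t)) has_real_derivative g' t) (at t)" for t
    using extends[OF geodesic_in_H2[OF p e]] by simp
  have pU: "p \<in> U" using p H2_subset by blast
  have c0: "?c 0 = p" by (simp add: geodesic_def)
  have d: "((\<lambda>t. F' (?c t) v) has_real_derivative F'' p v e) (at 0)" for v
  proof -
    have "linear (F'' p v)" using second[OF pU] has_derivative_linear by blast
    then show ?thesis
      unfolding has_field_derivative_def
      by (intro has_derivative_eq_rhs[OF has_derivative_compose[OF c second[OF cU]]])
         (simp add: fun_eq_iff c0 linear_scale mult.commute)
  qed
  have "(g' has_real_derivative F' p p + F'' p e e) (at 0)"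
    unfolding g'_def by (auto intro!: derivative_eq_intros d simp: c0)
  then have "(g' has_real_derivative Hess u p e e) (at 0)"
    by (simp add: Hess_eq[OF p e(1,1)] e(2) add.commute)
  from that[OF 1 this] show thesis .
qed

lemma second_derivative_at_max:
  fixes g :: "real \<Rightarrow> real"
  assumes g: "\<And>t. (g has_real_derivative g' t) (at t)"
    and g': "(g' has_real_derivative l) (at a)" and max: "\<And>t. g t \<le> g a"
  shows "l \<le> 0"
proof (rule ccontr)
  assume "\<not> l \<le> 0"
  have "g' a = 0"
    by (rule DERIV_local_max[OF g, of 1 a]) (use max in auto)
  with \<open>\<not> l \<le> 0\<close> obtain d where d: "d > 0" "\<And>h. 0 < h \<Longrightarrow> h < d \<Longrightarrow> g' (a + h) > 0"
    using DERIV_pos_inc_right[OF g'] by force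
  obtain z where z: "a < z" "z < a + d / 2" "g (a + d / 2) - g a = (a + d / 2 - a) * g' z"
    using MVT2[of a "a + d / 2" g g'] g d(1) by auto
  have "g' z > 0" using d(2)[of "z - a"] z d(1) by auto
  then have "(a + d / 2 - a) * g' z > 0" using d(1) by simp
  then have "g (a + d / 2) - g a > 0" by (simp only: z(3))
  then show False using max[of "a + d / 2"] by simp
qed

text \<open>
  The maximum principle for \<open>laplacian u = 2 u\<close>. The coordinate function \<open>p $ 1\<close> solves the equation
  itself; adding the constant \<open>1\<close> makes it a strict supersolution, since
  \<open>laplacian (p $ 1 + 1) - 2 * (p $ 1 + 1) = - 2\<close>. If \<open>u1 - u2\<close> touched a positive multiple
  \<open>M\<close> of it from below, the difference would have the positive Laplacian \<open>2 * M\<close> at a maximum.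
\<close>

lemma touching_maximum_contradiction:
  assumes "C2_extension u1 U1 F1 F1' F1''" "C2_extension u2 U2 F2 F2' F2''"
    and lap1: "\<And>p. p \<in> H2 \<Longrightarrow> laplacian u1 p = 2 * u1 p"
    and lap2: "\<And>p. p \<in> H2 \<Longrightarrow> laplacian u2 p = 2 * u2 p"
    and le: "\<And>q. q \<in> H2 \<Longrightarrow> u1 q - u2 q \<le> M * (q $ 1 + 1)"
    and p: "p \<in> H2" and touch: "u1 p - u2 p = M * (p $ 1 + 1)"
  shows "M \<le> 0"
proof -
  interpret u1: C2_extension u1 U1 F1 F1' F1'' by fact
  interpret u2: C2_extension u2 U2 F2 F2' F2'' by fact
  obtain e f where fr: "orthonormal_frame p e f" by (rule orthonormal_frame_exists[OF p])
  have *: "Hess u1 p e e - Hess u2 p e e - M * p $ 1 \<le> 0"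
    if e: "e \<in> tangent p" "mink e e = 1" for e
  proof -
    obtain g1 where g1: "\<And>t. ((\<lambda>t. u1 (geodesic p e t)) has_real_derivative g1 t) (at t)"
      "(g1 has_real_derivative Hess u1 p e e) (at 0)"
      by (rule u1.second_derivative_along_geodesic[OF p e]) blast
    obtain g2 where g2: "\<And>t. ((\<lambda>t. u2 (geodesic p e t)) has_real_derivative g2 t) (at t)"
      "(g2 has_real_derivative Hess u2 p e e) (at 0)"
      by (rule u2.second_derivative_along_geodesic[OF p e]) blast
    let ?g = "\<lambda>t. u1 (geodesic p e t) - u2 (geodesic p e t) - M * (geodesic p e t $ 1 + 1)"
    show ?thesis
    proof (rule second_derivative_at_max)
      show "(?g has_real_derivative g1 t - g2 t - M * (sinh t * p $ 1 + cosh t * e $ 1)) (at t)" for t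
        unfolding geodesic_def[of p e t, symmetric]
        by (intro DERIV_diff g1 g2 DERIV_cmult)
           (auto simp: geodesic_def intro!: derivative_eq_intros)
      show "((\<lambda>t. g1 t - g2 t - M * (sinh t * p $ 1 + cosh t * e $ 1)) has_real_derivative
          Hess u1 p e e - Hess u2 p e e - M * p $ 1) (at 0)"
        by (intro DERIV_diff g1 g2 DERIV_cmult) (auto intro!: derivative_eq_intros)
      have "geodesic p e 0 = p" by (simp add: geodesic_def)
      then show "?g t \<le> ?g 0" for t
        using le[OF geodesic_in_H2[OF p e, of t]] touch by simp
    qed
  qed
  have "laplacian u1 p - laplacian u2 p \<le> 2 * M * p $ 1"
    using *[of e] *[of f] fr
    by (simp add: u1.laplacian_eq[OF p fr] u2.laplacian_eq[OF p fr] orthonormal_frame_def)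
  moreover have "laplacian u1 p - laplacian u2 p = 2 * M * (p $ 1 + 1)"
    using touch by (simp add: lap1[OF p] lap2[OF p])
  ultimately show ?thesis by (simp add: algebra_simps)
qed

section \<open>The disk model and affine functions\<close>

text \<open>
  The inverse of the radial projection, that is, the Klein model of the hyperbolic plane. In it
  linear functions on \<open>H2\<close> become affine functions on the disk, up to the factor \<open>p $ 1\<close>.
\<close>

definition klein :: "complex \<Rightarrow> real^3" where
  "klein \<eta> = (1 / sqrt (1 - (norm \<eta>)\<^sup>2)) *\<^sub>R vector [1, Re \<eta>, Im \<eta>]"

lemma sqrt_disk_factor:
  assumes p: "p \<in> H2"
  shows "1 - (norm (radial_proj p))\<^sup>2 = (1 / p $ 1)\<^sup>2"
    and "sqrt (1 - (norm (radial_proj p))\<^sup>2) = 1 / p $ 1"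
proof -
  have p1: "p $ 1 > 0" "(p $ 1)\<^sup>2 = 1 + (p $ 2)\<^sup>2 + (p $ 3)\<^sup>2" using p by (auto simp: H2_iff)
  have "(norm (radial_proj p))\<^sup>2 = ((p $ 2)\<^sup>2 + (p $ 3)\<^sup>2) / (p $ 1)\<^sup>2"
    by (simp add: radial_proj_def cmod_def power_divide add_divide_distrib)
  also have "\<dots> = ((p $ 1)\<^sup>2 - 1) / (p $ 1)\<^sup>2" by (simp add: p1(2))
  finally show 1: "1 - (norm (radial_proj p))\<^sup>2 = (1 / p $ 1)\<^sup>2"
    using p1(1) by (simp add: diff_divide_distrib power_divide)
  show "sqrt (1 - (norm (radial_proj p))\<^sup>2) = 1 / p $ 1"
    unfolding 1 using p1(1) by simp
qed

lemma radial_proj_in_ball: "p \<in> H2 \<Longrightarrow> radial_proj p \<in> ball 0 1"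
  using sqrt_disk_factor(1)[of p]
  by (smt (verit) H2_iff divide_pos_pos mem_ball_0 norm_ge_zero power2_eq_square
      mult_less_cancel_right1 mult_mono one_power2 power_mono zero_less_power)

lemma klein_radial_proj: "p \<in> H2 \<Longrightarrow> klein (radial_proj p) = p"
  unfolding klein_def sqrt_disk_factor(2)
  by (rule vec3_eqI) (auto simp: radial_proj_def H2_iff)

lemma klein_in_H2:
  assumes "\<eta> \<in> ball 0 1"
  shows "klein \<eta> \<in> H2"
proof -
  have "(norm \<eta>)\<^sup>2 < 1" using assms by (simp add: power_less_one_iff abs_square_less_1)
  moreover have "(norm \<eta>)\<^sup>2 = (Re \<eta>)\<^sup>2 + (Im \<eta>)\<^sup>2" by (simp add: cmod_power2)
  ultimately show ?thesis by (simp add: H2_iff klein_def power_divide field_simps)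
qed

lemma radial_proj_klein: "\<eta> \<in> ball 0 1 \<Longrightarrow> radial_proj (klein \<eta>) = \<eta>"
  using klein_in_H2[of \<eta>] by (simp add: klein_def radial_proj_def H2_iff complex_eq_iff)

lemma inv_radial_proj:
  assumes "\<eta> \<in> ball 0 1"
  shows "the_inv_into H2 radial_proj \<eta> = klein \<eta>"
proof (rule the_inv_into_f_eq)
  show "inj_on radial_proj H2" by (rule inj_on_inverseI[of _ klein]) (rule klein_radial_proj)
qed (use assms in \<open>auto simp: klein_in_H2 radial_proj_klein\<close>)

lemma disk_fun_radial_proj: "p \<in> H2 \<Longrightarrow> disk_fun u (radial_proj p) = u p / p $ 1"
  unfolding disk_fun_def
  by (simp only: sqrt_disk_factor(2) inv_radial_proj radial_proj_in_ball klein_radial_proj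
      times_divide_eq_left mult_1)

lemma continuous_on_klein: "continuous_on (ball 0 1) klein"
proof -
  have e: "klein \<eta> = (1 / sqrt (1 - (norm \<eta>)\<^sup>2)) *\<^sub>R (axis 1 1 + Re \<eta> *\<^sub>R axis 2 1 + Im \<eta> *\<^sub>R axis 3 1)" for \<eta>
    unfolding klein_def by (rule vec3_eqI) (simp_all add: axis_def)
  have "(norm \<eta>)\<^sup>2 \<noteq> 1" if "\<eta> \<in> ball 0 1" for \<eta> :: complex
    using that by (simp add: power2_eq_1_iff) (smt (verit) norm_ge_zero)
  then show ?thesis unfolding e
    by (intro continuous_intros) auto
qed

lemma affine_fun_vector:
  assumes "affine_fun a"
  obtains c where "\<And>t. a (cis t) = horo c t" "\<And>p. p \<in> H2 \<Longrightarrow> p $ 1 * a (radial_proj p) = - mink p c"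
proof -
  obtain l k where l: "linear l" "a = (\<lambda>z. l z + k)" using assms by (auto simp: affine_fun_def)
  have a: "a z = k + Re z * l 1 + Im z * l \<i>" for z
  proof -
    have "l z = l (Re z *\<^sub>R 1 + Im z *\<^sub>R \<i>)"
      by (rule arg_cong[of _ _ l]) (simp add: complex_eq_iff)
    also have "\<dots> = Re z * l 1 + Im z * l \<i>"
      by (simp only: linear_add[OF l(1)] linear_scale[OF l(1)] real_scaleR_def)
    finally show ?thesis using l(2) by simp
  qed
  define c :: "real^3" where "c = vector [k, - l 1, - l \<i>]"
  have "a (cis t) = horo c t" for t by (simp add: a[of "cis t"] c_def horo_eq)
  moreover have "p $ 1 * a (radial_proj p) = - mink p c" if "p \<in> H2" for p
    using that unfolding a by (simp add: c_def mink_def radial_proj_def H2_iff field_simps)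
  ultimately show thesis by (rule that)
qed

lemma affine_fun_inner: "affine_fun (\<lambda>z. k + r * (z \<bullet> w))"
  unfolding affine_fun_def
  by (rule exI[of _ "\<lambda>z. r * (z \<bullet> w)"], rule exI[of _ k]) (auto intro!: linearI simp: algebra_simps)

lemma affine_fun_const: "affine_fun (\<lambda>z. k)"
  using affine_fun_inner[of k 0] by simp

lemma affine_fun_continuous: "affine_fun a \<Longrightarrow> continuous_on S a"
  unfolding affine_fun_def linear_conv_bounded_linear
  by (elim exE conjE) (simp add: continuous_on_add linear_continuous_on)

section \<open>The Poisson integral and its Hessian\<close>

definition poisson :: "(complex \<Rightarrow> real) \<Rightarrow> real^3 \<Rightarrow> real" where
  "poisson f x = horo_integral (\<lambda>t. f (cis t)) 2 x / (2 * pi)"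

lemma continuous_on_cis_compose:
  "continuous_on (sphere 0 1) f \<Longrightarrow> continuous_on {0..2 * pi} (\<lambda>t. f (cis t))"
  by (rule continuous_on_compose2[of "sphere 0 1" f]) (auto intro: continuous_intros)

lemma poisson_eq_horo_integral:
  assumes "continuous_on (sphere 0 1) f" "x \<in> timecone"
  shows "poisson f x = horo_integral (\<lambda>t. f (cis t) / (2 * pi)) 2 x"
  using horo_integral_simps(3)[OF continuous_on_cis_compose continuous_on_cis_compose, of f f x "1 / (2 * pi)" 2]
    assms by (simp add: poisson_def)

lemma poisson_mono:
  assumes "continuous_on (sphere 0 1) f" "continuous_on (sphere 0 1) g"
    and "\<And>z. z \<in> sphere 0 1 \<Longrightarrow> f z \<le> g z" and "p \<in> H2"
  shows "poisson f p \<le> poisson g p"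
  unfolding poisson_def using assms H2_subset_timecone
  by (intro divide_right_mono horo_integral_mono continuous_on_cis_compose) auto

lemma poisson_affine:
  assumes "affine_fun a" "p \<in> H2"
  shows "poisson a p = p $ 1 * a (radial_proj p)"
proof -
  obtain c where c: "\<And>t. a (cis t) = horo c t" "p $ 1 * a (radial_proj p) = - mink p c"
    using affine_fun_vector[OF assms(1)] assms(2) by metis
  show ?thesis unfolding poisson_def c using horo_integral_linear[OF assms(2), of c] by simp
qed

lemma poisson_between_affine:
  assumes f: "continuous_on (sphere 0 1) f" and p: "p \<in> H2" and a: "affine_fun a"
  shows "(\<forall>z\<in>sphere 0 1. f z \<le> a z) \<Longrightarrow> poisson f p \<le> p $ 1 * a (radial_proj p)"
    and "(\<forall>z\<in>sphere 0 1. a z \<le> f z) \<Longrightarrow> p $ 1 * a (radial_proj p) \<le> poisson f p"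
  using poisson_mono[OF f affine_fun_continuous[OF a] _ p]
    poisson_mono[OF affine_fun_continuous[OF a] f _ p] poisson_affine[OF a p] by auto

text \<open>
  The linear term is kept because the estimate needs the potential in the form of an integral with
  nonnegative density plus a linear function.
\<close>

lemma horo_integral_C2_extension:
  assumes \<psi>: "continuous_on {0..2 * pi} \<psi>"
    and u: "\<And>x. x \<in> H2 \<Longrightarrow> u x = horo_integral \<psi> 2 x - mink x c"
  shows "C2_extension u timecone (\<lambda>x. horo_integral \<psi> 2 x - mink x c)
    (\<lambda>x v. horo_integral (\<lambda>t. - 2 * \<psi> t * horo v t) 3 x - mink v c)
    (\<lambda>x v w. horo_integral (\<lambda>t. 6 * \<psi> t * horo v t * horo w t) 4 x)"
proof
  have m: "((\<lambda>x. mink x c) has_derivative (\<lambda>v. mink v c)) (at x)" for x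
    by (rule bounded_linear_imp_has_derivative[OF bounded_bilinear.bounded_linear_left[OF bounded_bilinear_mink]])
  fix x v :: "real^3" assume x: "x \<in> timecone"
  show "((\<lambda>x. horo_integral \<psi> 2 x - mink x c) has_derivative
      (\<lambda>v. horo_integral (\<lambda>t. - 2 * \<psi> t * horo v t) 3 x - mink v c)) (at x)"
    using has_derivative_diff[OF has_derivative_horo_integral[OF \<psi> x, of 2] m]
    by (simp add: numeral_3_eq_3 numeral_2_eq_2)
  have "continuous_on {0..2 * pi} (\<lambda>t. - 2 * \<psi> t * horo v t)"
    by (intro continuous_intros \<psi> continuous_on_horo)
  from has_derivative_diff[OF has_derivative_horo_integral[OF this x, of 3] has_derivative_const[of "mink v c"]]
  show "((\<lambda>y. horo_integral (\<lambda>t. - 2 * \<psi> t * horo v t) 3 y - mink v c) has_derivative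
      (\<lambda>w. horo_integral (\<lambda>t. 6 * \<psi> t * horo v t * horo w t) 4 x)) (at x)"
    by (simp add: eval_nat_numeral mult.assoc)
qed (use u H2_subset_timecone open_timecone in auto)

text \<open>
  The trace-free Hessian. The linear term drops out because it satisfies \<open>Hess u = u g\<close>; for
  \<open>horo powr (-2)\<close> the ambient Hessian is \<open>6 * horo powr (-4)\<close> times the square of the differential
  and the Euler relation turns the normal derivative into \<open>- 2 * horo powr (-2)\<close>.
\<close>

lemma Hess_minus_metric:
  assumes \<psi>: "continuous_on {0..2 * pi} \<psi>"
    and u: "\<And>x. x \<in> H2 \<Longrightarrow> u x = horo_integral \<psi> 2 x - mink x c"
    and p: "p \<in> H2" and v: "v \<in> tangent p" and w: "w \<in> tangent p"
  shows "Hess u p v w - u p * mink v w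
    = horo_integral (\<lambda>t. \<psi> t * (6 * horo v t * horo w t - 3 * mink v w * (horo p t)\<^sup>2)) 4 p"
proof -
  interpret C2_extension u timecone "\<lambda>x. horo_integral \<psi> 2 x - mink x c"
    "\<lambda>x v. horo_integral (\<lambda>t. - 2 * \<psi> t * horo v t) 3 x - mink v c"
    "\<lambda>x v w. horo_integral (\<lambda>t. 6 * \<psi> t * horo v t * horo w t) 4 x"
    by (rule horo_integral_C2_extension[OF \<psi> u])
  have x: "p \<in> timecone" using p H2_subset_timecone by blast
  have 1: "horo_integral (\<lambda>t. - 2 * \<psi> t * horo p t) 3 p = - 2 * horo_integral \<psi> 2 p"
    unfolding horo_integral_simps(3)[OF \<psi> \<psi> x, symmetric] unfolding horo_integral_def
    by (intro integral_cong) (simp add: horo_nonzero[OF x] eval_nat_numeral)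
  have 2: "horo_integral \<psi> 2 p = horo_integral (\<lambda>t. \<psi> t * (horo p t)\<^sup>2) 4 p"
    unfolding horo_integral_def
    by (intro integral_cong) (simp add: horo_nonzero[OF x] eval_nat_numeral)
  have c: "continuous_on {0..2 * pi} (\<lambda>t. \<psi> t * (horo p t)\<^sup>2)"
    "continuous_on {0..2 * pi} (\<lambda>t. 6 * \<psi> t * horo w t * horo v t)"
    by (intro continuous_intros \<psi> continuous_on_horo)+
  have "Hess u p v w - u p * mink v w = horo_integral (\<lambda>t. 6 * \<psi> t * horo w t * horo v t) 4 p
      - 3 * mink v w * horo_integral (\<lambda>t. \<psi> t * (horo p t)\<^sup>2) 4 p"
    unfolding Hess_eq[OF p v w] 1 u[OF p] 2 by (simp add: algebra_simps)
  also have "\<dots> = horo_integral (\<lambda>t. 6 * \<psi> t * horo w t * horo v t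
      - 3 * mink v w * (\<psi> t * (horo p t)\<^sup>2)) 4 p"
    by (subst horo_integral_simps(2)[OF c(2) _ x])
       (auto intro: continuous_on_mult c(1) simp: horo_integral_simps(3)[OF c(1) c(1) x])
  also have "\<dots> = horo_integral (\<lambda>t. \<psi> t * (6 * horo v t * horo w t - 3 * mink v w * (horo p t)\<^sup>2)) 4 p"
    by (simp add: algebra_simps)
  finally show ?thesis .
qed

lemma horo_tangential_part:
  assumes p: "p \<in> H2"
  obtains m where "m \<in> tangent p" "mink m m = (horo p t)\<^sup>2" "\<And>v. v \<in> tangent p \<Longrightarrow> mink m v = - horo v t"
proof
  have pp: "mink p p = -1" and pr: "mink p (ray t) = - horo p t" "mink (ray t) p = - horo p t"
    using p by (simp_all add: H2_def horo_def mink_commute)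
  show "tproj p (ray t) \<in> tangent p" by (rule tproj_tangent[OF p])
  show "mink (tproj p (ray t)) (tproj p (ray t)) = (horo p t)\<^sup>2"
    by (simp add: tproj_def mink_simps pp pr mink_ray_ray power2_eq_square)
  show "mink (tproj p (ray t)) v = - horo v t" if "v \<in> tangent p" for v
    by (subst mink_tproj[OF that]) (simp add: horo_def mink_commute)
qed

text \<open>
  With \<open>m\<close> the tangential part of \<open>ray t\<close>, of length \<open>horo p t\<close>, the bilinear form is
  \<open>3 * (horo p t)\<^sup>2\<close> times \<open>(v, w) \<mapsto> mink (R v) w\<close>, where \<open>R\<close> is the reflection fixing \<open>m\<close>.
  A reflection is an isometry, so the Cauchy-Schwarz inequality gives the sharp constant.
\<close>

lemma traceless_kernel_bound:
  assumes p: "p \<in> H2" and v: "v \<in> tangent p" and w: "w \<in> tangent p"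
  shows "\<bar>6 * horo v t * horo w t - 3 * mink v w * (horo p t)\<^sup>2\<bar>
    \<le> 3 * (horo p t)\<^sup>2 * (gnorm v * gnorm w)"
proof -
  let ?h = "horo p t"
  obtain m where m: "m \<in> tangent p" "mink m m = ?h\<^sup>2" "\<And>v. v \<in> tangent p \<Longrightarrow> mink m v = - horo v t"
    using horo_tangential_part[OF p] by blast
  define s where "s = ?h\<^sup>2"
  have ms: "mink m m = s" by (simp add: s_def m)
  define q where "q = (2 * mink m v) *\<^sub>R m - s *\<^sub>R v"
  have q: "q \<in> tangent p" unfolding q_def by (intro tangent_combination m v)
  have "mink q q = s\<^sup>2 * mink v v"
    by (simp add: q_def mink_simps ms mink_commute[of v m] algebra_simps power2_eq_square)
  moreover have "s \<ge> 0" by (simp add: s_def)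
  ultimately have "gnorm q = s * gnorm v"
    by (simp add: gnorm_def real_sqrt_mult)
  moreover have "mink q w = 2 * mink m v * mink m w - mink v w * s"
    by (simp add: q_def mink_simps)
  then have "mink q w = 2 * horo v t * horo w t - mink v w * s" by (simp add: m v w)
  ultimately have "\<bar>2 * horo v t * horo w t - mink v w * ?h\<^sup>2\<bar> \<le> ?h\<^sup>2 * gnorm v * gnorm w"
    using mink_Cauchy_Schwarz[OF p q w] by (simp add: s_def)
  then show ?thesis by (simp add: abs_le_iff algebra_simps)
qed

lemma Hess_minus_metric_bound:
  assumes \<psi>: "continuous_on {0..2 * pi} \<psi>" and pos: "\<And>t. \<psi> t \<ge> 0"
    and u: "\<And>x. x \<in> H2 \<Longrightarrow> u x = horo_integral \<psi> 2 x - mink x c"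
    and p: "p \<in> H2" and v: "v \<in> tangent p" and w: "w \<in> tangent p"
  shows "\<bar>Hess u p v w - u p * mink v w\<bar> \<le> 3 * (u p + mink p c) * (gnorm v * gnorm w)"
proof -
  let ?K = "\<lambda>t. 6 * horo v t * horo w t - 3 * mink v w * (horo p t)\<^sup>2"
  let ?B = "3 * (gnorm v * gnorm w)"
  have x: "p \<in> timecone" using p H2_subset_timecone by blast
  have c: "continuous_on {0..2 * pi} (\<lambda>t. \<psi> t * ?K t)" "continuous_on {0..2 * pi} (\<lambda>t. \<psi> t * (horo p t)\<^sup>2)"
    by (intro continuous_intros \<psi> continuous_on_horo)+
  have c': "continuous_on {0..2 * pi} (\<lambda>t. r * (\<psi> t * (horo p t)\<^sup>2))" for r
    using c(2) by (rule continuous_on_mult[OF continuous_on_const])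
  have b: "\<bar>\<psi> t * ?K t\<bar> \<le> ?B * (\<psi> t * (horo p t)\<^sup>2)" for t
  proof -
    have "\<bar>\<psi> t * ?K t\<bar> = \<psi> t * \<bar>?K t\<bar>" using pos[of t] by (simp only: abs_mult abs_of_nonneg)
    also have "\<dots> \<le> \<psi> t * (3 * (horo p t)\<^sup>2 * (gnorm v * gnorm w))"
      by (rule mult_left_mono[OF traceless_kernel_bound[OF p v w] pos])
    finally show ?thesis by (simp add: algebra_simps)
  qed
  have "horo_integral (\<lambda>t. \<psi> t * ?K t) 4 p \<le> horo_integral (\<lambda>t. ?B * (\<psi> t * (horo p t)\<^sup>2)) 4 p"
    by (rule horo_integral_mono[OF c(1) c' x]) (use b in \<open>simp add: abs_le_iff\<close>)
  moreover have "horo_integral (\<lambda>t. (- ?B) * (\<psi> t * (horo p t)\<^sup>2)) 4 p \<le> horo_integral (\<lambda>t. \<psi> t * ?K t) 4 p"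
    by (rule horo_integral_mono[OF c' c(1) x]) (use b in \<open>simp add: abs_le_iff minus_le_iff\<close>)
  moreover have "horo_integral (\<lambda>t. \<psi> t * (horo p t)\<^sup>2) 4 p = u p + mink p c"
  proof -
    have "horo_integral (\<lambda>t. \<psi> t * (horo p t)\<^sup>2) 4 p = horo_integral \<psi> 2 p"
      unfolding horo_integral_def
      by (intro integral_cong) (simp add: horo_nonzero[OF x] eval_nat_numeral)
    then show ?thesis by (simp add: u[OF p])
  qed
  ultimately have "\<bar>horo_integral (\<lambda>t. \<psi> t * ?K t) 4 p\<bar> \<le> ?B * (u p + mink p c)"
    unfolding horo_integral_simps(3)[OF c(2) c(2) x] by (simp add: abs_le_iff)
  moreover have "Hess u p v w - u p * mink v w = horo_integral (\<lambda>t. \<psi> t * ?K t) 4 p"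
    by (rule Hess_minus_metric[OF \<psi> _ p v w]) (rule u)
  ultimately show ?thesis by (simp only: mult.assoc mult.commute mult.left_commute)
qed

text \<open>
  Let \<open>A\<close> be the Hessian of \<open>u\<close> viewed as an endomorphism. As \<open>J\<close> is parallel with square \<open>-1\<close>,
  \<open>dbar V\<close> is half the commutator \<open>J A - A J\<close>, and in the commutator the multiple \<open>u p\<close> of the identity
  cancels. What remains is controlled by the trace-free Hessian. Subtracting the affine minorant
  \<open>a\<close> from the boundary values makes the density nonnegative, so that the kernel bound
  integrates to a multiple of the Poisson integral itself.
\<close>

lemma dbar_rotated_gradient_bound:
  assumes f: "continuous_on (sphere 0 1) f" and u: "\<And>x. x \<in> H2 \<Longrightarrow> u x = poisson f x"
    and V: "\<And>x. x \<in> H2 \<Longrightarrow> V x = J x (grad u x)"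
    and a: "affine_fun a" "\<And>z. z \<in> sphere 0 1 \<Longrightarrow> a z \<le> f z"
    and p: "p \<in> H2" and v: "v \<in> tangent p" "gnorm v \<le> 1"
  shows "gnorm (dbar V p v) \<le> 3 * (u p - p $ 1 * a (radial_proj p))"
proof -
  obtain c where c: "\<And>t. a (cis t) = horo c t" "\<And>p. p \<in> H2 \<Longrightarrow> p $ 1 * a (radial_proj p) = - mink p c"
    using affine_fun_vector[OF a(1)] by blast
  define \<psi> where "\<psi> t = (f (cis t) - horo c t) / (2 * pi)" for t
  have \<psi>: "continuous_on {0..2 * pi} \<psi>"
    unfolding \<psi>_def by (intro continuous_intros continuous_on_cis_compose f continuous_on_horo) auto
  have pos: "\<psi> t \<ge> 0" for t
    using a(2)[of "cis t"] by (simp add: \<psi>_def c)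
  have u\<psi>: "u x = horo_integral \<psi> 2 x - mink x c" if x: "x \<in> H2" for x
  proof -
    have tc: "x \<in> timecone" using x H2_subset_timecone by blast
    note cf = continuous_on_cis_compose[OF f]
    have "horo_integral \<psi> 2 x = horo_integral (\<lambda>t. (1 / (2 * pi)) * (f (cis t) - horo c t)) 2 x"
      by (simp add: \<psi>_def[abs_def])
    also have "\<dots> = (1 / (2 * pi)) * (horo_integral (\<lambda>t. f (cis t)) 2 x - horo_integral (horo c) 2 x)"
      by (simp only: horo_integral_simps(3)[OF continuous_on_diff[OF cf continuous_on_horo(2)] cf tc]
          horo_integral_simps(2)[OF cf continuous_on_horo(2) tc])
    finally show ?thesis
      by (simp add: u[OF x] poisson_def horo_integral_linear[OF x] field_simps)
  qed
  interpret C2_extension u timecone "\<lambda>x. horo_integral \<psi> 2 x - mink x c"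
    "\<lambda>x v. horo_integral (\<lambda>t. - 2 * \<psi> t * horo v t) 3 x - mink v c"
    "\<lambda>x v w. horo_integral (\<lambda>t. 6 * \<psi> t * horo v t * horo w t) 4 x"
    by (rule horo_integral_C2_extension[OF \<psi> u\<psi>])
  define K where "K = 3 * (u p + mink p c)"
  define A where "A = nabla (grad u) p"
  have A: "A x \<in> tangent p" for x by (simp add: A_def nabla_tangent[OF p])
  have bound: "\<bar>mink (A x) y - u p * mink x y\<bar> \<le> K * (gnorm x * gnorm y)"
    if "x \<in> tangent p" "y \<in> tangent p" for x y
    using Hess_minus_metric_bound[OF \<psi> pos u\<psi> p that] by (simp add: K_def A_def Hess_def)
  have K: "K \<ge> 0"
    using poisson_between_affine(2)[OF f p a(1)] a(2) c(2)[OF p] by (simp add: K_def u[OF p])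
  have Jmove: "mink (J p x) y = - mink x (J p y)" for x y
    by (simp add: J_def mink_mcross_cycle)
  have rot: "nabla V p x = J p (A x)" if "x \<in> tangent p" for x
    unfolding A_def by (rule nabla_rotated_gradient[OF p that]) (rule V)
  have d: "dbar V p v = (1 / 2) *\<^sub>R (J p (A v) - A (J p v))"
    by (simp add: dbar_def rot v J_tangent J_J[OF p A])
  have t: "dbar V p v \<in> tangent p"
    unfolding d by (intro tangent_combination J_tangent A)
  have "\<bar>mink (dbar V p v) w\<bar> \<le> K * gnorm w" if w: "w \<in> tangent p" for w
  proof -
    have "2 * mink (dbar V p v) w = - (mink (A v) (J p w) - u p * mink v (J p w))
        - (mink (A (J p v)) w - u p * mink (J p v) w)"
      unfolding d by (simp add: mink_simps Jmove)
    also have "\<bar>\<dots>\<bar> \<le> K * (gnorm v * gnorm w) + K * (gnorm v * gnorm w)"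
      using bound[OF v(1) J_tangent[of p w]] bound[OF J_tangent[of p v] w]
      by (simp add: gnorm_J[OF p] v w)
    also have "\<dots> \<le> 2 * (K * gnorm w)"
      using mult_right_mono[OF v(2) gnorm_nonneg[OF p w]] K by (simp add: mult_left_mono)
    finally show ?thesis by simp
  qed
  from gnorm_le_by_duality[OF p t this] show ?thesis
    using K by (auto simp: K_def c(2)[OF p])
qed

section \<open>Existence and uniqueness of the potential\<close>

text \<open>
  The integrand of the trace of \<open>Hess u - u g\<close> vanishes pointwise because \<open>ray t\<close> is lightlike: the
  squared length of its tangential part is \<open>(horo p t)\<^sup>2\<close>.
\<close>

lemma poisson_laplacian:
  assumes f: "continuous_on (sphere 0 1) f" and p: "p \<in> H2"
  shows "laplacian (poisson f) p = 2 * poisson f p"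
proof -
  define \<psi> where "\<psi> t = f (cis t) / (2 * pi)" for t
  have \<psi>: "continuous_on {0..2 * pi} \<psi>"
    unfolding \<psi>_def by (intro continuous_intros continuous_on_cis_compose f) auto
  have u: "poisson f x = horo_integral \<psi> 2 x - mink x 0" if "x \<in> H2" for x
    using poisson_eq_horo_integral[OF f, of x] that H2_subset_timecone
    by (auto simp: \<psi>_def[abs_def] mink_def)
  interpret C2_extension "poisson f" timecone "\<lambda>x. horo_integral \<psi> 2 x - mink x 0"
    "\<lambda>x v. horo_integral (\<lambda>t. - 2 * \<psi> t * horo v t) 3 x - mink v 0"
    "\<lambda>x v w. horo_integral (\<lambda>t. 6 * \<psi> t * horo v t * horo w t) 4 x"
    by (rule horo_integral_C2_extension[OF \<psi> u])
  have x: "p \<in> timecone" using p H2_subset_timecone by blast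
  obtain e f' where fr: "orthonormal_frame p e f'" by (rule orthonormal_frame_exists[OF p])
  then have t: "e \<in> tangent p" "f' \<in> tangent p" "mink e e = 1" "mink f' f' = 1"
    by (auto simp: orthonormal_frame_def)
  let ?S = "\<lambda>v t. \<psi> t * (6 * horo v t * horo v t - 3 * 1 * (horo p t)\<^sup>2)"
  have null: "horo e t * horo e t + horo f' t * horo f' t = (horo p t)\<^sup>2" for t
  proof -
    obtain m where m: "m \<in> tangent p" "mink m m = (horo p t)\<^sup>2" "\<And>v. v \<in> tangent p \<Longrightarrow> mink m v = - horo v t"
      using horo_tangential_part[OF p] by blast
    show ?thesis using orthonormal_frame_Parseval[OF p fr m(1,1)] m t by simp
  qed
  have c: "continuous_on {0..2 * pi} (?S v)" for v
    by (intro continuous_intros \<psi> continuous_on_horo)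
  have "?S e t + ?S f' t = 0" for t
  proof -
    have "?S e t + ?S f' t = \<psi> t * (6 * (horo e t * horo e t + horo f' t * horo f' t) - 6 * (horo p t)\<^sup>2)"
      by (simp add: algebra_simps)
    then show ?thesis by (simp add: null)
  qed
  then have "horo_integral (?S e) 4 p + horo_integral (?S f') 4 p = 0"
    unfolding horo_integral_simps(1)[OF c c x, symmetric] by (simp add: horo_integral_def)
  then show ?thesis
    using Hess_minus_metric[OF \<psi> u p t(1,1)] Hess_minus_metric[OF \<psi> u p t(2,2)]
    by (simp add: laplacian_eq[OF p fr] t)
qed

lemma poisson_smooth:
  assumes "continuous_on (sphere 0 1) f"
  shows "smooth_on_H2 (poisson f)"
proof -
  define \<psi> where "\<psi> t = f (cis t) / (2 * pi)" for t
  have \<psi>: "continuous_on {0..2 * pi} \<psi>"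
    unfolding \<psi>_def by (intro continuous_intros continuous_on_cis_compose assms) auto
  have u: "horo_integral \<psi> 2 x = poisson f x" if "x \<in> H2" for x
    using poisson_eq_horo_integral[OF assms, of x] that H2_subset_timecone
    by (auto simp: \<psi>_def[abs_def])
  show ?thesis unfolding smooth_on_H2_def
    using Ck_on_horo_integral[OF \<psi>] open_timecone H2_subset_timecone u by blast
qed

lemma continuous_on_circle_bounded:
  assumes "continuous_on (sphere (0::complex) 1) (f :: complex \<Rightarrow> real)"
  obtains B where "\<And>z. z \<in> sphere 0 1 \<Longrightarrow> \<bar>f z\<bar> \<le> B"
proof -
  have "bounded (f ` sphere 0 1)"
    by (intro compact_imp_bounded compact_continuous_image assms) simp
  then obtain B where "\<forall>y\<in>f ` sphere 0 1. norm y \<le> B" unfolding bounded_iff by blast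
  then show thesis by (intro that[of B]) simp
qed

text \<open>
  Continuity of \<open>f\<close> at \<open>w\<close>, expressed by affine functions of \<open>z\<close>: on the unit circle
  \<open>1 - z \<bullet> w\<close> is half the squared distance from \<open>z\<close> to \<open>w\<close>, so a large multiple of it
  absorbs the oscillation of \<open>f\<close> away from \<open>w\<close>.
\<close>

lemma affine_modulus:
  assumes f: "continuous_on (sphere 0 1) f" and w: "w \<in> sphere (0::complex) 1" and "\<epsilon> > (0::real)"
  obtains C where "C \<ge> 0" "\<And>z. z \<in> sphere 0 1 \<Longrightarrow> \<bar>f z - f w\<bar> \<le> \<epsilon> + C * (1 - z \<bullet> w)"
proof -
  obtain d where d: "d > 0" "\<And>z. z \<in> sphere 0 1 \<Longrightarrow> dist z w < d \<Longrightarrow> dist (f z) (f w) < \<epsilon>"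
    using f w \<open>\<epsilon> > 0\<close> unfolding continuous_on_iff by blast
  obtain B where B: "\<And>z. z \<in> sphere 0 1 \<Longrightarrow> \<bar>f z\<bar> \<le> B"
    using continuous_on_circle_bounded[OF f] by blast
  have "B \<ge> 0" using B[OF w] by simp
  show thesis
  proof
    show "4 * B / d\<^sup>2 \<ge> 0" using \<open>B \<ge> 0\<close> by simp
    fix z assume z: "z \<in> sphere (0::complex) 1"
    have dz: "(dist z w)\<^sup>2 = 2 * (1 - z \<bullet> w)"
      using z w by (simp add: dist_norm power2_norm_eq_inner inner_diff inner_commute norm_eq_1)
    then have nn: "1 - z \<bullet> w \<ge> 0" by (smt (verit) zero_le_power2)
    show "\<bar>f z - f w\<bar> \<le> \<epsilon> + 4 * B / d\<^sup>2 * (1 - z \<bullet> w)"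
    proof (cases "dist z w < d")
      case True
      moreover have "4 * B / d\<^sup>2 * (1 - z \<bullet> w) \<ge> 0" using nn \<open>B \<ge> 0\<close> by simp
      ultimately show ?thesis using d(2)[OF z] by (simp add: dist_real_def)
    next
      case False
      then have "d\<^sup>2 \<le> 2 * (1 - z \<bullet> w)" using d(1) unfolding dz[symmetric] by (intro power_mono) auto
      then have "(2 * B / d\<^sup>2) * d\<^sup>2 \<le> (2 * B / d\<^sup>2) * (2 * (1 - z \<bullet> w))"
        using \<open>B \<ge> 0\<close> by (intro mult_left_mono) auto
      moreover have "(2 * B / d\<^sup>2) * d\<^sup>2 = 2 * B" using d(1) by simp
      moreover have "(2 * B / d\<^sup>2) * (2 * (1 - z \<bullet> w)) = 4 * B / d\<^sup>2 * (1 - z \<bullet> w)" by simp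
      ultimately have "2 * B \<le> 4 * B / d\<^sup>2 * (1 - z \<bullet> w)" by (simp only:)
      then show ?thesis using B[OF z] B[OF w] \<open>\<epsilon> > 0\<close> by linarith
    qed
  qed
qed

text \<open>
  A Korovkin-type argument: the Poisson integral is monotone and reproduces affine functions, so
  the affine bounds for \<open>f\<close> near a boundary point \<open>w\<close> are inherited by the extension inside the
  disk.
\<close>

lemma poisson_boundary_values:
  assumes f: "continuous_on (sphere 0 1) f"
  shows "continuous_on (cball 0 1) (\<lambda>\<eta>. if \<eta> \<in> ball 0 1 then disk_fun (poisson f) \<eta> else f \<eta>)"
    (is "continuous_on _ ?h")
  unfolding continuous_on_eq_continuous_within
proof
  fix w :: complex assume w: "w \<in> cball 0 1"
  show "continuous (at w within cball 0 1) ?h"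
  proof (cases "w \<in> ball 0 1")
    case True
    have "continuous_on timecone (poisson f)"
      using Ck_on_horo_integral[OF continuous_on_cis_compose[OF f], of 0 2]
      unfolding poisson_def[abs_def] by (intro continuous_intros) auto
    then have "continuous_on (ball 0 1) (\<lambda>\<eta>. poisson f (klein \<eta>))"
      using klein_in_H2 H2_subset_timecone
      by (intro continuous_on_compose2[OF _ continuous_on_klein]) auto
    then have "continuous_on (ball 0 1) (\<lambda>\<eta>. sqrt (1 - (norm \<eta>)\<^sup>2) * poisson f (klein \<eta>))"
      by (intro continuous_intros)
    then have "continuous_on (ball 0 1) ?h"
      by (rule continuous_on_eq) (simp only: disk_fun_def inv_radial_proj if_True)
    then have "isCont ?h w" using True by (simp add: continuous_on_eq_continuous_at)
    then show ?thesis by (rule continuous_at_imp_continuous_at_within)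
  next
    case False
    with w have w1: "w \<in> sphere 0 1" by auto
    have "\<forall>\<^sub>F \<eta> in at w within cball 0 1. dist (?h \<eta>) (f w) < e" if e: "e > 0" for e
    proof -
      obtain C where C: "C \<ge> 0" "\<And>z. z \<in> sphere 0 1 \<Longrightarrow> \<bar>f z - f w\<bar> \<le> e / 2 + C * (1 - z \<bullet> w)"
        using affine_modulus[OF f w1, of "e / 2"] e by auto
      have sandwich: "\<bar>?h \<eta> - f w\<bar> \<le> e / 2 + C * (1 - \<eta> \<bullet> w)" if "\<eta> \<in> cball 0 1" for \<eta>
      proof (cases "\<eta> \<in> ball 0 1")
        case True
        define p where "p = klein \<eta>"
        have p: "p \<in> H2" and rp: "radial_proj p = \<eta>"
          using True by (simp_all only: p_def klein_in_H2 radial_proj_klein)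
        have p1: "p $ 1 > 0" using p by (simp add: H2_iff)
        define a where "a = (\<lambda>z. (f w + e / 2 + C) + (- C) * (z \<bullet> w))"
        define a' where "a' = (\<lambda>z. (f w - e / 2 - C) + C * (z \<bullet> w))"
        have "affine_fun a" "affine_fun a'" unfolding a_def a'_def by (rule affine_fun_inner)+
        moreover have "a' z \<le> f z \<and> f z \<le> a z" if "z \<in> sphere 0 1" for z
          using C(2)[OF that, unfolded abs_le_iff] by (simp add: a_def a'_def algebra_simps)
        ultimately have "poisson f p \<le> p $ 1 * a \<eta>" "p $ 1 * a' \<eta> \<le> poisson f p"
          using poisson_between_affine[OF f p] rp by auto
        then have "a' \<eta> \<le> poisson f p / p $ 1 \<and> poisson f p / p $ 1 \<le> a \<eta>"
          using p1 by (simp add: field_simps)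
        moreover have "?h \<eta> = poisson f p / p $ 1"
          using True disk_fun_radial_proj[OF p, of "poisson f"] rp by simp
        ultimately have "?h \<eta> - f w \<le> e / 2 + C * (1 - \<eta> \<bullet> w) \<and>
            - (?h \<eta> - f w) \<le> e / 2 + C * (1 - \<eta> \<bullet> w)"
          by (simp add: a_def a'_def algebra_simps)
        then show ?thesis unfolding abs_le_iff .
      next
        case False
        then show ?thesis using that C(2)[of \<eta>] by simp
      qed
      have "((\<lambda>\<eta>. e / 2 + C * (1 - \<eta> \<bullet> w)) \<longlongrightarrow> e / 2 + C * (1 - w \<bullet> w)) (at w within cball 0 1)"
        by (intro tendsto_intros)
      moreover have "w \<bullet> w = 1" using w1 by (simp add: norm_eq_1)
      ultimately have "\<forall>\<^sub>F \<eta> in at w within cball 0 1. e / 2 + C * (1 - \<eta> \<bullet> w) < e"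
        using e order_tendstoD(2)[of _ "e / 2" _ e] by simp
      moreover have "\<forall>\<^sub>F \<eta> in at w within cball 0 1. \<eta> \<in> cball 0 1"
        by (simp add: eventually_at_filter)
      ultimately show ?thesis
      proof eventually_elim
        case (elim \<eta>)
        then show ?case unfolding dist_real_def
          using sandwich[OF elim(2)] elim(1) by linarith
      qed
    qed
    moreover have "?h w = f w" using False by simp
    ultimately show ?thesis unfolding continuous_within tendsto_iff by simp
  qed
qed

lemma support_fun_eq:
  assumes "X z \<bullet> z = 0" and z: "z \<in> sphere 0 1"
  shows "support_fun X z = Im (X z * cnj z)"
proof -
  have zz: "z * cnj z = 1" using z by (simp add: complex_norm_square[symmetric])
  have "Re (X z * cnj z) = 0" using assms(1) by (simp add: inner_complex_def)
  then have X: "X z * cnj z = \<i> * complex_of_real (Im (X z * cnj z))"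
    by (simp add: complex_eq_iff)
  have eq: "X z = \<i> * z * complex_of_real r \<longleftrightarrow> X z * cnj z = \<i> * complex_of_real r" for r
  proof
    assume "X z = \<i> * z * complex_of_real r"
    then have "X z * cnj z = \<i> * (z * cnj z) * complex_of_real r" by (simp add: mult_ac)
    then show "X z * cnj z = \<i> * complex_of_real r" by (simp add: zz)
  next
    assume "X z * cnj z = \<i> * complex_of_real r"
    then have "X z * (z * cnj z) = \<i> * z * complex_of_real r" by (metis mult.assoc mult.commute)
    then show "X z = \<i> * z * complex_of_real r" by (simp add: zz)
  qed
  show ?thesis unfolding support_fun_def eq
    by (rule the_equality, rule X) simp
qed

lemma continuous_on_support_fun:
  assumes "continuous_circle_field X"
  shows "continuous_on (sphere 0 1) (support_fun X)"
proof -
  have "continuous_on (sphere 0 1) (\<lambda>z. Im (X z * cnj z))"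
    using assms by (intro continuous_intros) (auto simp: continuous_circle_field_def)
  then show ?thesis
    by (rule continuous_on_eq) (use assms in \<open>simp add: continuous_circle_field_def support_fun_eq\<close>)
qed

lemma poisson_is_HL_potential:
  assumes "continuous_circle_field X"
  shows "is_HL_potential X (poisson (support_fun X))"
proof -
  note f = continuous_on_support_fun[OF assms]
  show ?thesis unfolding is_HL_potential_def
    using poisson_smooth[OF f] poisson_laplacian[OF f] poisson_boundary_values[OF f]
    by (intro conjI exI[of _ "\<lambda>\<eta>. if \<eta> \<in> ball 0 1 then disk_fun (poisson (support_fun X)) \<eta> else support_fun X \<eta>"])
       auto
qed

text \<open>
  In the disk the quotient of \<open>u1 - u2\<close> by the supersolution \<open>p $ 1 + 1\<close> is the function \<open>g\<close>. It
  is continuous on the closed disk and vanishes on the circle, so a positive maximum would be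
  attained inside, against the maximum principle.
\<close>

lemma HL_potential_le:
  assumes u1: "is_HL_potential X u1" and u2: "is_HL_potential X u2" and q: "q \<in> H2"
  shows "u1 q \<le> u2 q"
proof -
  obtain h1 where h1: "continuous_on (cball 0 1) h1" "\<And>\<eta>. \<eta> \<in> ball 0 1 \<Longrightarrow> h1 \<eta> = disk_fun u1 \<eta>"
    "\<And>z. z \<in> sphere 0 1 \<Longrightarrow> h1 z = support_fun X z"
    using u1 unfolding is_HL_potential_def by blast
  obtain h2 where h2: "continuous_on (cball 0 1) h2" "\<And>\<eta>. \<eta> \<in> ball 0 1 \<Longrightarrow> h2 \<eta> = disk_fun u2 \<eta>"
    "\<And>z. z \<in> sphere 0 1 \<Longrightarrow> h2 z = support_fun X z"
    using u2 unfolding is_HL_potential_def by blast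
  obtain U1 F1 F1' F1'' where e1: "C2_extension u1 U1 F1 F1' F1''"
    using u1 smooth_on_H2_C2_extension unfolding is_HL_potential_def by blast
  obtain U2 F2 F2' F2'' where e2: "C2_extension u2 U2 F2 F2' F2''"
    using u2 smooth_on_H2_C2_extension unfolding is_HL_potential_def by blast
  have lap: "laplacian u1 p = 2 * u1 p" "laplacian u2 p = 2 * u2 p" if "p \<in> H2" for p
    using u1 u2 that by (auto simp: is_HL_potential_def)
  define g where "g \<eta> = (h1 \<eta> - h2 \<eta>) / (1 + sqrt (1 - (norm \<eta>)\<^sup>2))" for \<eta>
  have "1 + sqrt (1 - (norm \<eta>)\<^sup>2) \<noteq> 0" if "\<eta> \<in> cball 0 1" for \<eta> :: complex
  proof -
    have "sqrt (1 - (norm \<eta>)\<^sup>2) \<ge> 0" using that by (simp add: power_le_one)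
    then show ?thesis by linarith
  qed
  then have "continuous_on (cball 0 1) g"
    unfolding g_def by (intro continuous_intros h1(1) h2(1)) auto
  then obtain w where w: "w \<in> cball 0 1" "\<And>\<eta>. \<eta> \<in> cball 0 1 \<Longrightarrow> g \<eta> \<le> g w"
    using continuous_attains_sup[of "cball 0 1" g] by auto
  have diff: "u1 p - u2 p = g (radial_proj p) * (p $ 1 + 1)" if p: "p \<in> H2" for p
  proof -
    have p1: "p $ 1 > 0" using p by (simp add: H2_iff)
    have "g (radial_proj p) = (u1 p / p $ 1 - u2 p / p $ 1) / (1 + 1 / p $ 1)"
      by (simp only: g_def h1(2)[OF radial_proj_in_ball[OF p]] h2(2)[OF radial_proj_in_ball[OF p]]
          disk_fun_radial_proj[OF p] sqrt_disk_factor(2)[OF p])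
    also have "\<dots> = (u1 p - u2 p) / (p $ 1 + 1)" using p1 by (simp add: divide_simps)
    finally show ?thesis using p1 by simp
  qed
  have le: "u1 p - u2 p \<le> g w * (p $ 1 + 1)" if p: "p \<in> H2" for p
  proof -
    have "g (radial_proj p) \<le> g w" using radial_proj_in_ball[OF p] by (intro w(2)) auto
    moreover have "p $ 1 + 1 \<ge> 0" using p by (simp add: H2_iff)
    ultimately show ?thesis unfolding diff[OF p] by (rule mult_right_mono)
  qed
  have "g w \<le> 0"
  proof (cases "w \<in> ball 0 1")
    case True
    have "u1 (klein w) - u2 (klein w) = g w * (klein w $ 1 + 1)"
      using diff[OF klein_in_H2[OF True]] radial_proj_klein[OF True] by simp
    from touching_maximum_contradiction[OF e1 e2 lap le klein_in_H2[OF True] this] show ?thesis .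
  next
    case False
    then show ?thesis using w(1) h1(3)[of w] h2(3)[of w] by (simp add: g_def)
  qed
  moreover have "q $ 1 + 1 \<ge> 0" using q by (simp add: H2_iff)
  ultimately have "g w * (q $ 1 + 1) \<le> 0" by (rule mult_nonpos_nonneg)
  then show ?thesis using le[OF q] by linarith
qed

text \<open>
  Existence makes the choice in \<open>HL_potential\<close> meaningful, and uniqueness identifies the chosen
  potential with the Poisson integral.
\<close>

lemma HL_potential_eq_poisson:
  assumes "continuous_circle_field X" and p: "p \<in> H2"
  shows "HL_potential X p = poisson (support_fun X) p"
proof -
  note 1 = poisson_is_HL_potential[OF assms(1)]
  have 2: "is_HL_potential X (HL_potential X)"
    unfolding HL_potential_def by (rule someI[of "is_HL_potential X", OF 1])
  show ?thesis by (rule antisym[OF HL_potential_le[OF 2 1 p] HL_potential_le[OF 1 2 p]])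
qed

section \<open>The estimate by the width\<close>

text \<open>
  Bounds on the supremum and the infimum need both families to be nonempty; the constant
  functions \<open>-B\<close> and \<open>B\<close> provide members.
\<close>

lemma le_width:
  assumes X: "continuous_circle_field X"
    and le: "\<And>a b. affine_fun a \<Longrightarrow> affine_fun b \<Longrightarrow> (\<forall>z\<in>sphere 0 1. a z \<le> support_fun X z) \<Longrightarrow>
      (\<forall>z\<in>sphere 0 1. support_fun X z \<le> b z) \<Longrightarrow> r \<le> b \<eta> - a \<eta>"
  shows "r \<le> phi_plus X \<eta> - phi_minus X \<eta>"
proof -
  let ?L = "{a \<eta> | a. affine_fun a \<and> (\<forall>\<zeta>\<in>sphere 0 1. a \<zeta> \<le> support_fun X \<zeta>)}"
  let ?R = "{a \<eta> | a. affine_fun a \<and> (\<forall>\<zeta>\<in>sphere 0 1. support_fun X \<zeta> \<le> a \<zeta>)}"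
  obtain B where B: "\<And>z. z \<in> sphere 0 1 \<Longrightarrow> \<bar>support_fun X z\<bar> \<le> B"
    using continuous_on_circle_bounded[OF continuous_on_support_fun[OF X]] by blast
  have "- B \<in> ?L" "B \<in> ?R"
    using affine_fun_const[of "- B"] affine_fun_const[of B] B by (force simp: abs_le_iff)+
  then have ne: "?L \<noteq> {}" "?R \<noteq> {}" by blast+
  have "x \<le> Inf ?R - r" if "x \<in> ?L" for x
  proof -
    have "r + x \<le> Inf ?R"
      by (rule cInf_greatest[OF ne(2)]) (use that le in force)
    then show ?thesis by simp
  qed
  then have "Sup ?L \<le> Inf ?R - r" by (rule cSup_least[OF ne(1)])
  then show ?thesis by (simp add: phi_plus_def phi_minus_def)
qed

theorem proposition7p1:
  fixes X :: "complex \<Rightarrow> complex"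
  assumes "continuous_circle_field X"
  shows "\<forall>p\<in>H2. tangent_opnorm p (dbar (HL X) p) \<le> 6 * width_fun X (radial_proj p)"
proof
  fix p assume p: "p \<in> H2"
  then have p1: "p $ 1 > 0" by (simp add: H2_iff)
  note f = continuous_on_support_fun[OF assms]
  note u = HL_potential_eq_poisson[OF assms]
  let ?\<eta> = "radial_proj p"
  have "gnorm (dbar (HL X) p v) \<le> 6 * width_fun X ?\<eta>" if v: "v \<in> tangent p" "gnorm v \<le> 1" for v
  proof -
    let ?G = "gnorm (dbar (HL X) p v)"
    have "?G / (3 * p $ 1) \<le> phi_plus X ?\<eta> - phi_minus X ?\<eta>"
    proof (rule le_width[OF assms])
      fix a b assume a: "affine_fun a" "\<forall>z\<in>sphere 0 1. a z \<le> support_fun X z"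
        and b: "affine_fun b" "\<forall>z\<in>sphere 0 1. support_fun X z \<le> b z"
      have "?G \<le> 3 * (HL_potential X p - p $ 1 * a ?\<eta>)"
        using a by (intro dbar_rotated_gradient_bound[OF f u _ _ _ p v]) (auto simp: HL_def)
      also have "\<dots> \<le> 3 * (p $ 1 * b ?\<eta> - p $ 1 * a ?\<eta>)"
        using poisson_between_affine(1)[OF f p b] by (simp add: u[OF p])
      finally show "?G / (3 * p $ 1) \<le> b ?\<eta> - a ?\<eta>" using p1 by (simp add: field_simps)
    qed
    then have "?G \<le> 3 * width_fun X ?\<eta>"
      using p1 by (simp add: width_fun_def sqrt_disk_factor(2)[OF p] field_simps)
    moreover have "?G \<ge> 0"
      by (rule gnorm_nonneg[OF p]) (simp add: dbar_def tangent_combination nabla_tangent[OF p] J_tangent)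
    ultimately show ?thesis by simp
  qed
  moreover have "0 \<in> {v \<in> tangent p. gnorm v \<le> 1}"
    by (simp add: tangent_def gnorm_def mink_def)
  ultimately show "tangent_opnorm p (dbar (HL X) p) \<le> 6 * width_fun X ?\<eta>"
    unfolding tangent_opnorm_def by (intro cSUP_least) auto
qed

end
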